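(* Let $m\in\mathbb{N}^+$. For $i=0,\dots,m-1$ define $$z^{(m)}_{i,p}(x)=\frac{1}{M^{(m)}_{i,p}}\,u^{(m)}_p\Big(\frac{|x|}{(M^{(m)}_{i,p})^{\frac{p-1}{2}}}\Big),\qquad x\in\widetilde T^{(m)}_{i,p}:=(M^{(m)}_{i,p})^{\frac{p-1}{2}}T^{(m)}_{i,p},$$ where $T^{(m)}_{i,p}=\bigcup_{j=i}^{m-1}B^{(m)}_{j,p}$. Let $U(x)=\big(\frac{N(N-2)}{N(N-2)+|x|^2}\big)^{\frac{N-2}{2}}$. Then as $p\to p_S^-$: $z^{(m)}_{0,p}\to U$ in $C^2_{loc}(\mathbb{R}^N)$, and, if $m\geq2$, $(-1)^iz^{(m)}_{i,p}\to U$ in $C^2_{loc}(\mathbb{R}^N\setminus\{0\})$ for every $i=1,\dots,m-1$. (Convergence in $C^2_{loc}(D)$ means: every compact $K\subset D$ is contained in the domain of the functions for $p$ close to $p_S$, and the $C^2(K)$-distance to $U$ tends to $0$.)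
   Context: Standing setting: $N\geq3$, $B$ unit ball of $\mathbb{R}^N$ centered at $0$, $p_S=\frac{N+2}{N-2}$. $u^{(m)}_p$ is the unique radial solution of $-\Delta u=|u|^{p-1}u$ in $B$, $u=0$ on $\partial B$, with exactly $m$ nodal regions and $u^{(m)}_p(0)>0$. Nodal radii $0<r^{(m)}_{1,p}<\dots<r^{(m)}_{m-1,p}<r^{(m)}_{m,p}:=1$; nodal regions $B^{(m)}_{0,p}=\{|x|<r^{(m)}_{1,p}\}$, $B^{(m)}_{i,p}=\{r^{(m)}_{i,p}<|x|<r^{(m)}_{i+1,p}\}$; $M^{(m)}_{i,p}=\max_{B^{(m)}_{i,p}}|u^{(m)}_p|$. *)

theory Defs
  imports "HOL-Analysis.Analysis"
begin

definition pd :: "'n::finite \<Rightarrow> (real^'n \<Rightarrow> real) \<Rightarrow> real^'n \<Rightarrow> real" where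
  "pd i f x = deriv (\<lambda>t. f (x + t *\<^sub>R axis i 1)) 0"

definition laplacian :: "(real^'n::finite \<Rightarrow> real) \<Rightarrow> real^'n \<Rightarrow> real" where
  "laplacian f x = (\<Sum>i\<in>UNIV. pd i (pd i f) x)"

definition C2_on :: "(real^'n::finite) set \<Rightarrow> (real^'n \<Rightarrow> real) \<Rightarrow> bool" where
  "C2_on S f \<longleftrightarrow> (\<exists>f' :: (real^'n) \<Rightarrow> ((real^'n) \<Rightarrow>\<^sub>L real).
      \<exists>f'' :: (real^'n) \<Rightarrow> ((real^'n) \<Rightarrow>\<^sub>L ((real^'n) \<Rightarrow>\<^sub>L real)).
        (\<forall>x\<in>S. (f has_derivative blinfun_apply (f' x)) (at x) \<and>
                 (f' has_derivative blinfun_apply (f'' x)) (at x)) \<and>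
        continuous_on S f'')"

definition pS :: "real \<Rightarrow> real" where
  "pS N = (N + 2) / (N - 2)"

definition radial_sol :: "nat \<Rightarrow> real \<Rightarrow> (real^'n::finite \<Rightarrow> real) \<Rightarrow> bool" where
  "radial_sol m p u \<longleftrightarrow>
     C2_on (ball 0 1) u \<and> continuous_on (cball 0 1) u \<and>
     (\<forall>x\<in>ball 0 1. - laplacian u x = \<bar>u x\<bar> powr (p - 1) * u x) \<and>
     (\<forall>x. norm x = 1 \<longrightarrow> u x = 0) \<and>
     (\<forall>x\<in>cball 0 1. \<forall>y\<in>cball 0 1. norm x = norm y \<longrightarrow> u x = u y) \<and>
     finite (components {x\<in>ball 0 1. u x \<noteq> 0}) \<and>
     card (components {x\<in>ball 0 1. u x \<noteq> 0}) = m \<and>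
     u 0 > 0"

definition nodal_radius :: "(real^'n::finite \<Rightarrow> real) \<Rightarrow> nat \<Rightarrow> nat \<Rightarrow> real" where
  "nodal_radius u m i =
     (if i = 0 then 0 else if m \<le> i then 1
      else sorted_list_of_set {norm x |x. x \<in> ball 0 1 \<and> u x = 0} ! (i - 1))"

definition nodal_region :: "(real^'n::finite \<Rightarrow> real) \<Rightarrow> nat \<Rightarrow> nat \<Rightarrow> (real^'n) set" where
  "nodal_region u m i =
     {x. (i = 0 \<or> nodal_radius u m i < norm x) \<and> norm x < nodal_radius u m (Suc i)}"

definition nodal_max :: "(real^'n::finite \<Rightarrow> real) \<Rightarrow> nat \<Rightarrow> nat \<Rightarrow> real" where
  "nodal_max u m i = Sup ((\<lambda>x. \<bar>u x\<bar>) ` nodal_region u m i)"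

definition T_set :: "(real^'n::finite \<Rightarrow> real) \<Rightarrow> nat \<Rightarrow> nat \<Rightarrow> (real^'n) set" where
  "T_set u m i = (\<Union>j\<in>{i..<m}. nodal_region u m j)"

definition z_resc :: "(real^'n::finite \<Rightarrow> real) \<Rightarrow> nat \<Rightarrow> real \<Rightarrow> nat \<Rightarrow> real^'n \<Rightarrow> real" where
  "z_resc u m p i x =
     u ((nodal_max u m i powr (- ((p - 1) / 2))) *\<^sub>R x) / nodal_max u m i"

definition z_dom :: "(real^'n::finite \<Rightarrow> real) \<Rightarrow> nat \<Rightarrow> real \<Rightarrow> nat \<Rightarrow> (real^'n) set" where
  "z_dom u m p i = (\<lambda>x. (nodal_max u m i powr ((p - 1) / 2)) *\<^sub>R x) ` T_set u m i"

definition U_bubble :: "real^'n::finite \<Rightarrow> real" where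
  "U_bubble x = (let N = real CARD('n) in
     (N * (N - 2) / (N * (N - 2) + (norm x)\<^sup>2)) powr ((N - 2) / 2))"

definition C2_dist :: "(real^'n::finite) set \<Rightarrow> (real^'n \<Rightarrow> real) \<Rightarrow> (real^'n \<Rightarrow> real) \<Rightarrow> real" where
  "C2_dist K f g = (let h = (\<lambda>x. f x - g x) in
     Sup (insert 0 ((\<lambda>x. \<bar>h x\<bar> + (\<Sum>i\<in>UNIV. \<bar>pd i h x\<bar>)
                         + (\<Sum>i\<in>UNIV. \<Sum>j\<in>UNIV. \<bar>pd i (pd j h) x\<bar>)) ` K)))"

definition C2loc_conv_left ::
  "(real \<Rightarrow> real^'n::finite \<Rightarrow> real) \<Rightarrow> (real \<Rightarrow> (real^'n) set) \<Rightarrow> (real^'n \<Rightarrow> real)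
     \<Rightarrow> (real^'n) set \<Rightarrow> real \<Rightarrow> bool" where
  "C2loc_conv_left f Dm g D p0 \<longleftrightarrow>
     (\<forall>K. compact K \<and> K \<subseteq> D \<longrightarrow>
        eventually (\<lambda>p. K \<subseteq> Dm p) (at_left p0) \<and>
        ((\<lambda>p. C2_dist K (f p) g) \<longlongrightarrow> 0) (at_left p0))"

end

theory Submission
  imports Defs
begin

text \<open>
  In the Emden--Fowler variable \<open>Y = r powr (2 / (p - 1)) * u\<close> the radial equation becomes an autonomous
  oscillator with a small negative friction \<open>k\<close>, and \<open>k\<close> tends to 0 as \<open>p\<close> tends to \<open>pS\<close>. The energy \<open>E\<close> starts
  at 0 and grows by at most a constant times \<open>k\<close> on each nodal interval, because \<open>dE = k Z dY\<close> and \<open>Y\<close>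
  turns only once there. Hence \<open>E\<close> is \<open>O(k)\<close> on the whole ball. At the maximum point \<open>\<rho>\<close> of
  \<open>\<bar>u\<bar>\<close> in the \<open>i\<close>-th nodal region this forces the scale-invariant quantity
  \<open>s = M powr ((p - 1) / 2) * \<rho>\<close> to tend to 0. So the rescaled profile leaves the value 1 with slope 0 at
  a radius \<open>s\<close> tending to 0, and by a Gronwall estimate it converges to the solution starting at 0, which
  is the bubble. Positivity of the bubble then pushes the next nodal radius to infinity.
\<close>

section \<open>The bubble\<close>

text \<open>The obstacle is that neither the size of \<open>M\<close> nor the ratio of the scales of
  neighbouring nodal regions is known in advance. Scale invariance gets round it: where
  \<open>v1\<close> vanishes, Z = \<alpha> Y, and since \<alpha>^2 - \<gamma> = \<alpha> k > 0 the
  quadratic part of the energy is nonnegative there. So small energy alone makes \<open>Y\<close>,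
  and with it s = |Y|^((p-1)/2), small; amplitude and radius never enter separately.

  The comparison with the bubble must survive the singular coefficient (n-1)/r while the initial
  radius s tends to 0. It is therefore run on the flux r^(n-1) (W' - bubble'), whose derivative
  contains no 1/r. The initial mismatch of the flux is at most s^n/n and reappears as (s/r)^n in the
  bound for (W' - bubble')/r, an ingredient of the Hessian. This is why the estimates reach the
  origin for i = 0, where s = 0, and stay away from it for i >= 1.

  Only p close to pS matter, so p >= N/(N-2) may be assumed. Then \<alpha> <= N-2 and \<gamma> >= 0,
  and together with p < pS <= 5 all constants become independent of p.\<close>

definition bubble :: "nat \<Rightarrow> real \<Rightarrow> real" where
  "bubble n r = (real n * (real n - 2) / (real n * (real n - 2) + r\<^sup>2)) powr ((real n - 2) / 2)"

definition bubble' :: "nat \<Rightarrow> real \<Rightarrow> real" where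
  "bubble' n r =
     - (r / real n) * (real n * (real n - 2) / (real n * (real n - 2) + r\<^sup>2)) powr (real n / 2)"

text \<open>Prescribed through the critical equation, so that subtracting it from another solution
  is immediate. At \<open>r = 0\<close> division by zero makes the value -1, whereas the true second
  derivative there is -1/n; the origin is treated separately in
  \<open>bubble'_deriv_0\<close>.\<close>

definition bubble'' :: "nat \<Rightarrow> real \<Rightarrow> real" where
  "bubble'' n r = - ((real n - 1) / r * bubble' n r) - bubble n r powr pS (real n)"

lemma U_bubble_eq: "U_bubble (x :: real^'n::finite) = bubble CARD('n) (norm x)"
  by (simp add: U_bubble_def bubble_def Let_def)

lemma bubble_base_pos:
  assumes "3 \<le> n"
  shows "0 < real n * (real n - 2)" "0 < real n * (real n - 2) + r\<^sup>2"
proof -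
  show "0 < real n * (real n - 2)" using assms by simp
  then show "0 < real n * (real n - 2) + r\<^sup>2" by (rule add_pos_nonneg) simp
qed

lemma bubble_pos: "3 \<le> n \<Longrightarrow> 0 < bubble n r"
  unfolding bubble_def using bubble_base_pos(1)[of n] bubble_base_pos(2)[of n r] by simp

lemma bubble_0: "3 \<le> n \<Longrightarrow> bubble n 0 = 1"
  using bubble_base_pos(1)[of n] by (simp add: bubble_def)

lemma bubble_antimono:
  assumes "3 \<le> n" "0 \<le> r" "r \<le> t"
  shows "bubble n t \<le> bubble n r"
  unfolding bubble_def
proof (rule powr_mono2)
  have "r\<^sup>2 \<le> t\<^sup>2" using assms by (intro power_mono) auto
  with bubble_base_pos[OF assms(1)]
  show "real n * (real n - 2) / (real n * (real n - 2) + t\<^sup>2)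
      \<le> real n * (real n - 2) / (real n * (real n - 2) + r\<^sup>2)"
    by (intro divide_left_mono mult_pos_pos) (auto intro: less_imp_le)
  show "0 \<le> real n * (real n - 2) / (real n * (real n - 2) + t\<^sup>2)"
    using bubble_base_pos[OF assms(1)] by (intro divide_nonneg_nonneg) (auto intro: less_imp_le)
qed (use assms in auto)

lemma bubble_le_1: "3 \<le> n \<Longrightarrow> 0 \<le> r \<Longrightarrow> bubble n r \<le> 1"
  using bubble_antimono[of n 0 r] by (simp add: bubble_0)

lemma bubble'_0 [simp]: "bubble' n 0 = 0"
  by (simp add: bubble'_def)

lemma abs_bubble'_le:
  assumes "3 \<le> n" "0 \<le> r"
  shows "\<bar>bubble' n r\<bar> \<le> r / real n"
proof -
  have "(real n * (real n - 2) / (real n * (real n - 2) + r\<^sup>2)) powr (real n / 2) \<le> 1"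
    using bubble_base_pos(1)[OF assms(1)] bubble_base_pos(2)[OF assms(1), of r]
    by (intro powr_le1) auto
  then have "r / real n * (real n * (real n - 2) / (real n * (real n - 2) + r\<^sup>2)) powr (real n / 2)
      \<le> r / real n * 1"
    using assms by (intro mult_left_mono) auto
  then show ?thesis using assms by (simp add: bubble'_def abs_mult)
qed

text \<open>Differentiation raises the exponent by one and produces a factor \<open>r\<close>, so
  one formula serves both \<open>bubble\<close>, with a = (n-2)/2, and \<open>bubble'\<close>, with
  a = n/2.\<close>

lemma bubble_base_deriv:
  assumes "3 \<le> n"
  shows "((\<lambda>r. (real n * (real n - 2) / (real n * (real n - 2) + r\<^sup>2)) powr a) has_real_derivative
    - (2 * a * r / (real n * (real n - 2))) *
      (real n * (real n - 2) / (real n * (real n - 2) + r\<^sup>2)) powr (a + 1)) (at r)"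
proof -
  define c where "c = real n * (real n - 2)"
  have c: "0 < c" "0 < c + r\<^sup>2" using bubble_base_pos[OF assms] by (auto simp: c_def)
  have q: "((\<lambda>r. c / (c + r\<^sup>2)) has_real_derivative - (2 * r * c / (c + r\<^sup>2)\<^sup>2)) (at r)"
    using c by (auto intro!: derivative_eq_intros simp: power2_eq_square)
  have "((\<lambda>r. (c / (c + r\<^sup>2)) powr a) has_real_derivative
     a * (c / (c + r\<^sup>2)) powr (a - 1) * - (2 * r * c / (c + r\<^sup>2)\<^sup>2)) (at r)"
    using DERIV_fun_powr[OF q, of a] c by simp
  moreover have "(c / (c + r\<^sup>2)) powr (a + 1) = (c / (c + r\<^sup>2)) powr (a - 1) * (c / (c + r\<^sup>2))\<^sup>2"
  proof -
    have "(c / (c + r\<^sup>2))\<^sup>2 = (c / (c + r\<^sup>2)) powr 2" using c by (simp add: powr_numeral)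
    then show ?thesis by (simp only: powr_add[symmetric]) (simp add: add.commute)
  qed
  moreover have "a * X * - (2 * r * c / (c + r\<^sup>2)\<^sup>2)
      = - (2 * a * r / c) * (X * (c / (c + r\<^sup>2))\<^sup>2)" for X
    using c by (simp add: field_simps power2_eq_square)
  ultimately show ?thesis unfolding c_def by simp
qed

lemma bubble_deriv:
  assumes "3 \<le> n"
  shows "(bubble n has_real_derivative bubble' n r) (at r)"
proof -
  have "- (2 * ((real n - 2) / 2) * r / (real n * (real n - 2))) = - (r / real n)"
    using assms by (simp add: field_simps)
  moreover have "(real n - 2) / 2 + 1 = real n / 2" by (simp add: diff_divide_distrib)
  ultimately show ?thesis
    using bubble_base_deriv[OF assms, of "(real n - 2) / 2" r]
    unfolding bubble_def[abs_def] bubble'_def by metis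
qed

lemma bubble'_deriv:
  assumes "3 \<le> n" "r \<noteq> 0"
  shows "(bubble' n has_real_derivative bubble'' n r) (at r)"
proof -
  define c where "c = real n * (real n - 2)"
  define X where "X = (c / (c + r\<^sup>2)) powr (real n / 2 + 1)"
  have c: "0 < c" "0 < c + r\<^sup>2" using bubble_base_pos[OF assms(1)] by (auto simp: c_def)
  have D: "(bubble' n has_real_derivative - (1 / real n) * (c / (c + r\<^sup>2)) powr (real n / 2)
     + - (r / real n) * (- (2 * (real n / 2) * r / c) * X)) (at r)"
    unfolding bubble'_def[abs_def] X_def c_def
    using DERIV_mult'[OF DERIV_minus[OF DERIV_cdivide[OF DERIV_ident, of "real n" r]]
        bubble_base_deriv[OF assms(1), of "real n / 2" r]] by (simp add: algebra_simps)
  have 1: "(c / (c + r\<^sup>2)) powr (real n / 2) = X * ((c + r\<^sup>2) / c)"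
    using c unfolding X_def powr_add by simp
  \<comment> \<open>Criticality enters here: it matches the nonlinearity with the power produced by
    the second differentiation.\<close>
  have 2: "bubble n r powr pS (real n) = X"
  proof -
    have "(real n - 2) / 2 * pS (real n) = real n / 2 + 1"
      using assms by (simp add: pS_def field_simps)
    then show ?thesis unfolding bubble_def powr_powr X_def c_def by metis
  qed
  have "bubble'' n r = (real n - 1) / real n * (X * ((c + r\<^sup>2) / c)) - X"
    unfolding bubble''_def 2 bubble'_def using assms 1 by (simp add: c_def)
  also have "\<dots> = - (1 / real n) * (X * ((c + r\<^sup>2) / c)) + - (r / real n) * (- (2 * (real n / 2) * r / c) * X)"
  proof -
    have "real n > 0" "real n \<noteq> 2" using assms by auto
    then show ?thesis using c by (simp add: field_simps power2_eq_square)
  qed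
  finally show ?thesis using D 1 by simp
qed

lemma bubble'_deriv_0:
  assumes "3 \<le> n"
  shows "(bubble' n has_real_derivative - (1 / real n)) (at 0)"
  unfolding bubble'_def[abs_def]
  using DERIV_mult'[OF DERIV_minus[OF DERIV_cdivide[OF DERIV_ident, of "real n" 0]]
      bubble_base_deriv[OF assms, of "real n / 2" 0]] assms by simp

lemma continuous_on_bubble: "3 \<le> n \<Longrightarrow> continuous_on S (bubble n)"
  using bubble_deriv by (intro DERIV_continuous_on) (blast intro: has_field_derivative_at_within)

lemma continuous_on_bubble':
  assumes "3 \<le> n"
  shows "continuous_on S (bubble' n)"
proof -
  have "real n * (real n - 2) + x\<^sup>2 \<noteq> 0" for x
    using bubble_base_pos(2)[OF assms, of x] by simp
  then show ?thesis
    unfolding bubble'_def using assms by (intro continuous_intros) auto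
qed

text \<open>Two errors are separated. At the fixed exponent \<open>p\<close> the power is Lipschitz
  on [0,1] with constant at most \<open>q\<close>, and changing the exponent costs y^p (1 - y^(q-p))
  <= (q-p) L. Only the second needs a lower bound on \<open>y\<close>, so \<open>w\<close>, the
  rescaled solution, may vanish.\<close>

lemma powr_diff_le:
  fixes w y p q L :: real
  assumes "0 \<le> w" "w \<le> 1" "exp (-L) \<le> y" "y \<le> 1" "1 < p" "p \<le> q" "0 \<le> L"
  shows "\<bar>w powr p - y powr q\<bar> \<le> q * \<bar>w - y\<bar> + (q - p) * L"
proof -
  have y: "0 < y" by (rule less_le_trans[OF exp_gt_zero assms(3)])
  have lip: "b powr p - a powr p \<le> q * (b - a)" "0 \<le> b powr p - a powr p"
    if "0 \<le> a" "a \<le> b" "b \<le> 1" for a b :: real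
  proof -
    show "0 \<le> b powr p - a powr p" using that assms by (simp add: powr_mono2)
    show "b powr p - a powr p \<le> q * (b - a)"
    proof (cases "a = b")
      case False
      then have ab: "a < b" using that by simp
      have "continuous_on {a..b} (\<lambda>x. x powr p)"
        using assms that by (intro continuous_on_powr' continuous_intros) auto
      moreover have "((\<lambda>x. x powr p) has_derivative (*) (p * x powr (p - 1))) (at x)" if "a < x" "x < b" for x
        using that \<open>0 \<le> a\<close> by (auto intro!: derivative_eq_intros simp: has_field_derivative_def[symmetric])
      ultimately obtain \<xi> where xi: "a < \<xi>" "\<xi> < b" "b powr p - a powr p = p * \<xi> powr (p - 1) * (b - a)"
        using mvt[OF ab, of "\<lambda>x. x powr p" "\<lambda>x. (*) (p * x powr (p - 1))"] by auto
      have "\<xi> powr (p - 1) \<le> 1" using xi that assms by (intro powr_le1) auto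
      then have "p * \<xi> powr (p - 1) \<le> q * 1" using assms by (intro mult_mono) auto
      then show ?thesis using xi ab by (simp add: mult_right_mono)
    qed simp
  qed
  have 1: "\<bar>w powr p - y powr p\<bar> \<le> q * \<bar>w - y\<bar>"
    using lip[of w y] lip[of y w] assms y by (cases "w \<le> y") auto
  have "y powr p - y powr q \<le> (q - p) * L" "0 \<le> y powr p - y powr q"
  proof -
    have e: "y powr q = y powr p * y powr (q - p)" by (simp add: powr_add[symmetric])
    have "1 - (q - p) * L \<le> exp (- ((q - p) * L))" using exp_ge_add_one_self[of "- ((q - p) * L)"] by simp
    also have "\<dots> = exp (-L) powr (q - p)" by (simp add: powr_def)
    also have "\<dots> \<le> y powr (q - p)" using assms by (intro powr_mono2) auto
    finally have l: "1 - y powr (q - p) \<le> (q - p) * L" by simp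
    have yp: "y powr p \<le> 1" "y powr (q - p) \<le> 1" using assms y by (auto intro!: powr_le1)
    have "y powr p * (1 - y powr (q - p)) \<le> 1 * (1 - y powr (q - p))"
      using yp by (intro mult_right_mono) auto
    then show "y powr p - y powr q \<le> (q - p) * L" using l by (simp add: e algebra_simps)
    show "0 \<le> y powr p - y powr q" using yp by (simp add: e mult_left_le)
  qed
  then have "\<bar>y powr p - y powr q\<bar> \<le> (q - p) * L" by simp
  with 1 show ?thesis using abs_triangle_ineq[of "w powr p - y powr p" "y powr p - y powr q"] by simp
qed

section \<open>Continuous dependence\<close>

text \<open>The bubble is the case \<open>s = 0\<close>, \<open>b = \<infinity>\<close>, \<open>p = pS n\<close>.\<close>
locale lane_emden_arc =
  fixes n :: nat and p s b :: real and W W1 W2 :: "real \<Rightarrow> real"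
  assumes n: "3 \<le> n" and p: "1 < p" "p \<le> pS (real n)" and s: "0 \<le> s" "s < b"
    and W_cont: "continuous_on {s..<b} W" and W1_cont: "continuous_on {s..<b} W1"
    and W_s: "W s = 1" and W1_s: "W1 s = 0"
    and W_deriv: "\<And>r. s < r \<Longrightarrow> r < b \<Longrightarrow> (W has_real_derivative W1 r) (at r)"
    and W1_deriv: "\<And>r. s < r \<Longrightarrow> r < b \<Longrightarrow> (W1 has_real_derivative W2 r) (at r)"
    and ode: "\<And>r. s < r \<Longrightarrow> r < b \<Longrightarrow> W2 r = - ((real n - 1) / r * W1 r) - W r powr p"
    and W_bounds: "\<And>r. s \<le> r \<Longrightarrow> r < b \<Longrightarrow> 0 \<le> W r \<and> W r \<le> 1"
begin

text \<open>Multiplication by r^(n-1) turns the radial Laplacian into a total derivative: the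
  coefficient (n-1)/r disappears and only the difference of the nonlinearities remains.\<close>

lemma flux_deriv:
  assumes "s < r" "r < b"
  shows "((\<lambda>r. r ^ (n - 1) * (W1 r - bubble' n r)) has_real_derivative
    - (r ^ (n - 1) * (W r powr p - bubble n r powr pS (real n)))) (at r)"
proof -
  define d where "d = n - 2"
  then have d: "n = Suc (Suc d)" using n by simp
  have r: "0 < r" using assms s by simp
  have "((\<lambda>r. r ^ Suc d * (W1 r - bubble' n r)) has_real_derivative
      real (Suc d) * r ^ d * (W1 r - bubble' n r) + (W2 r - bubble'' n r) * r ^ Suc d) (at r)"
    using DERIV_mult[OF DERIV_pow[of "Suc d"] DERIV_diff[OF W1_deriv[OF assms] bubble'_deriv[OF n, of r]]] r
    by simp
  moreover have "real (Suc d) * r ^ d * (W1 r - bubble' n r) + (W2 r - bubble'' n r) * r ^ Suc d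
      = - (r ^ Suc d * (W r powr p - bubble n r powr pS (real n)))"
  proof -
    have "real n - 1 = real (Suc d)" using d by simp
    then have "W2 r - bubble'' n r = - (real (Suc d) * (W1 r - bubble' n r) / r)
        - (W r powr p - bubble n r powr pS (real n))"
      by (simp add: ode[OF assms] bubble''_def algebra_simps diff_divide_distrib)
    then have "real (Suc d) * r ^ d * (W1 r - bubble' n r) + (W2 r - bubble'' n r) * r ^ Suc d
      = real (Suc d) * r ^ d * (W1 r - bubble' n r) + (- (real (Suc d) * (W1 r - bubble' n r) / r)
        - (W r powr p - bubble n r powr pS (real n))) * r ^ Suc d" by (rule arg_cong)
    also have "\<dots> = - (r ^ Suc d * (W r powr p - bubble n r powr pS (real n)))"
      using r by (simp add: field_simps)
    finally show ?thesis .
  qed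
  ultimately show ?thesis by (simp add: d)
qed

section \<open>Bootstrap estimates below the Gronwall barrier\<close>

context
  fixes \<delta> e L A r :: real
  assumes \<delta>: "0 < \<delta>" and e: "(pS (real n) - p) * L \<le> e" and L: "0 \<le> L"
    and L_le: "\<And>t. 0 \<le> t \<Longrightarrow> t \<le> A \<Longrightarrow> exp (-L) \<le> bubble n t"
    and r: "s < r" "r < b" "r \<le> A"
    and le: "\<And>t. s < t \<Longrightarrow> t < r \<Longrightarrow> \<bar>W t - bubble n t\<bar> \<le> \<delta> * exp (pS (real n) * t\<^sup>2 / 2)"
begin

abbreviation (input) "q \<equiv> pS (real n)"

lemma e_nonneg: "0 \<le> e"
  using e L p by (smt (verit) mult_nonneg_nonneg)

text \<open>Integrates \<open>flux_deriv\<close> from \<open>s\<close>. The term s^n/n is the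
  initial flux: \<open>W1 s = 0\<close>, so only the slope of the bubble contributes, and its
  modulus is at most s/n.\<close>

lemma flux_bound:
  assumes "s < t" "t \<le> r"
  shows "\<bar>t ^ (n - 1) * (W1 t - bubble' n t)\<bar>
    \<le> s ^ n / n + t ^ n / n * (q * \<delta> * exp (q * t\<^sup>2 / 2) + e)"
proof -
  define f where "f t = t ^ (n - 1) * (W1 t - bubble' n t)" for t
  define \<phi> where "\<phi> t = t ^ n / n * (q * \<delta> * exp (q * t\<^sup>2 / 2) + e)" for t
  define \<phi>' where "\<phi>' t = t ^ (n - 1) * (q * \<delta> * exp (q * t\<^sup>2 / 2) + e)
      + t ^ n / n * (q * \<delta> * (q * t * exp (q * t\<^sup>2 / 2)))" for t
  have q: "0 < q" using p by simp
  have n0: "t ^ n = t * t ^ (n - 1)" for t :: real using n by (cases n) auto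
  have "norm (f t - f s) \<le> \<phi> t - \<phi> s"
  proof (rule differentiable_bound_general)
    show "s < t" by fact
    have "continuous_on {s..t} W1" by (rule continuous_on_subset[OF W1_cont]) (use assms r in auto)
    moreover have "continuous_on {s..t} (bubble' n)"
      by (rule continuous_on_bubble'[OF n])
    ultimately show "continuous_on {s..t} f" unfolding f_def by (intro continuous_intros)
    show "continuous_on {s..t} \<phi>" unfolding \<phi>_def using n by (intro continuous_intros) auto
    fix x assume x: "s < x" "x < t"
    show "(f has_vector_derivative - (x ^ (n - 1) * (W x powr p - bubble n x powr q))) (at x)"
      using flux_deriv[of x] x assms r unfolding f_def by (simp add: has_real_derivative_iff_has_vector_derivative)
    have "(\<phi> has_real_derivative \<phi>' x) (at x)"
      unfolding \<phi>_def \<phi>'_def using n by (auto intro!: derivative_eq_intros simp: field_simps)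
    then show "(\<phi> has_vector_derivative \<phi>' x) (at x)"
      by (simp add: has_real_derivative_iff_has_vector_derivative)
    have x0: "0 < x" using x s by simp
    have "\<bar>W x powr p - bubble n x powr q\<bar> \<le> q * \<bar>W x - bubble n x\<bar> + (q - p) * L"
      using W_bounds[of x] L_le[of x] bubble_le_1[OF n, of x] x assms r x0 p L by (intro powr_diff_le) auto
    also have "\<dots> \<le> q * (\<delta> * exp (q * x\<^sup>2 / 2)) + e"
      using le[of x] x assms e q by (intro add_mono mult_left_mono) auto
    finally have "x ^ (n - 1) * \<bar>W x powr p - bubble n x powr q\<bar>
        \<le> x ^ (n - 1) * (q * \<delta> * exp (q * x\<^sup>2 / 2) + e)"
      using x0 by (intro mult_left_mono) (auto simp: mult.assoc)
    \<comment> \<open>The summand of \<open>\<phi>'\<close> that comes from differentiating the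
      exponential is nonnegative and is dropped; this is the price for the closed form of
      \<open>\<phi>\<close>.\<close>
    also have "\<dots> \<le> \<phi>' x" unfolding \<phi>'_def using x0 q \<delta> by simp
    finally show "norm (- (x ^ (n - 1) * (W x powr p - bubble n x powr q))) \<le> \<phi>' x"
      using x0 by (simp add: abs_mult)
  qed
  moreover have "0 \<le> \<phi> s" unfolding \<phi>_def using s q \<delta> e_nonneg by simp
  moreover have "\<bar>f s\<bar> \<le> s ^ n / n"
    unfolding f_def W1_s n0[of s] using abs_bubble'_le[OF n s(1)] s
    by (simp add: abs_mult mult.commute[of s] mult_left_mono flip: times_divide_eq_right)
  ultimately show ?thesis unfolding f_def \<phi>_def by simp
qed

text \<open>The weight exp(q r^2/2) reproduces itself: dividing the flux bound by t^(n-1), with 1/n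
  estimated by 1, leaves q \<delta> t exp(q t^2/2), the exact derivative of the barrier. Integration
  returns the barrier minus \<delta>, and this gain of \<delta> pays for the remaining
  terms.\<close>

lemma value_bound:
  "\<bar>W r - bubble n r\<bar> \<le> \<bar>1 - bubble n s\<bar> + s * r + e * r\<^sup>2 + \<delta> * exp (q * r\<^sup>2 / 2) - \<delta>"
proof -
  define \<phi> where "\<phi> t = s * t + e * t\<^sup>2 / 2 + \<delta> * exp (q * t\<^sup>2 / 2)" for t
  define \<phi>' where "\<phi>' t = s + e * t + \<delta> * (q * t * exp (q * t\<^sup>2 / 2))" for t
  have q: "0 < q" using p by simp
  have n0: "t ^ n = t * t ^ (n - 1)" for t :: real using n by (cases n) auto
  have "norm ((W r - bubble n r) - (W s - bubble n s)) \<le> \<phi> r - \<phi> s"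
  proof (rule differentiable_bound_general)
    show "s < r" by fact
    have "continuous_on {s..r} W" by (rule continuous_on_subset[OF W_cont]) (use r in auto)
    moreover have "continuous_on {s..r} (bubble n)"
      by (rule continuous_on_bubble[OF n])
    ultimately show "continuous_on {s..r} (\<lambda>t. W t - bubble n t)" by (intro continuous_intros)
    show "continuous_on {s..r} \<phi>" unfolding \<phi>_def by (intro continuous_intros) auto
    fix x assume x: "s < x" "x < r"
    show "((\<lambda>t. W t - bubble n t) has_vector_derivative (W1 x - bubble' n x)) (at x)"
      using DERIV_diff[OF W_deriv bubble_deriv[OF n], of x] x r
      by (simp add: has_real_derivative_iff_has_vector_derivative)
    have "(\<phi> has_real_derivative \<phi>' x) (at x)"
      unfolding \<phi>_def \<phi>'_def by (auto intro!: derivative_eq_intros)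
    then show "(\<phi> has_vector_derivative \<phi>' x) (at x)"
      by (simp add: has_real_derivative_iff_has_vector_derivative)
    have x0: "0 < x" using x s by simp
    have "x ^ (n - 1) * \<bar>W1 x - bubble' n x\<bar>
        \<le> s ^ n / n + x ^ n / n * (q * \<delta> * exp (q * x\<^sup>2 / 2) + e)"
      using flux_bound[of x] x x0 by (simp add: abs_mult)
    also have "\<dots> \<le> s ^ n + x ^ n * (q * \<delta> * exp (q * x\<^sup>2 / 2) + e)"
    proof (intro add_mono mult_right_mono)
      show "s ^ n / n \<le> s ^ n" "x ^ n / n \<le> x ^ n" using n s x0
        by (auto simp: divide_le_eq mult_le_cancel_left1)
      show "0 \<le> q * \<delta> * exp (q * x\<^sup>2 / 2) + e" using q \<delta> e_nonneg by simp
    qed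
    also have "s ^ n \<le> x ^ (n - 1) * s"
      unfolding n0[of s] using s x by (simp add: mult.commute[of s] mult_right_mono power_mono)
    also have "x ^ (n - 1) * s + x ^ n * (q * \<delta> * exp (q * x\<^sup>2 / 2) + e) = x ^ (n - 1) * \<phi>' x"
      unfolding \<phi>'_def n0[of x] by (simp add: algebra_simps)
    finally have "x ^ (n - 1) * \<bar>W1 x - bubble' n x\<bar> \<le> x ^ (n - 1) * \<phi>' x" by simp
    then show "norm (W1 x - bubble' n x) \<le> \<phi>' x" using x0 by simp
  qed
  moreover have "\<phi> r - \<phi> s \<le> s * r + e * r\<^sup>2 + \<delta> * exp (q * r\<^sup>2 / 2) - \<delta>"
  proof -
    have "\<delta> * 1 \<le> \<delta> * exp (q * s\<^sup>2 / 2)" using \<delta> q by (intro mult_left_mono) auto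
    moreover have "0 \<le> s * s" "0 \<le> e * s\<^sup>2" "0 \<le> e * r\<^sup>2" using e_nonneg by auto
    ultimately show ?thesis unfolding \<phi>_def by linarith
  qed
  ultimately show ?thesis using W_s by simp
qed

end

text \<open>Continuation argument: at the first point where the barrier is touched
  \<open>value_bound\<close> applies, and \<open>small\<close> makes its right-hand side strictly
  less than the barrier.\<close>

lemma close_to_bubble:
  fixes \<delta> e L A r :: real
  assumes \<delta>: "0 < \<delta>" and e: "(pS (real n) - p) * L \<le> e" and L: "0 \<le> L"
    and L_le: "\<And>t. 0 \<le> t \<Longrightarrow> t \<le> A \<Longrightarrow> exp (-L) \<le> bubble n t"
    and small: "\<bar>1 - bubble n s\<bar> + s * A + e * A\<^sup>2 < \<delta>"
    and r: "s \<le> r" "r < b" "r \<le> A"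
  shows "\<bar>W r - bubble n r\<bar> \<le> \<delta> * exp (pS (real n) * r\<^sup>2 / 2)"
proof (rule ccontr)
  assume neg: "\<not> ?thesis"
  define F where "F t = \<delta> * exp (pS (real n) * t\<^sup>2 / 2) - \<bar>W t - bubble n t\<bar>" for t
  define S where "S = {t \<in> {s..r}. F t \<le> 0}"
  have q: "0 < pS (real n)" using p by simp
  have e0: "0 \<le> e" using e L p by (smt (verit) mult_nonneg_nonneg)
  have A: "0 \<le> A" using r s by simp
  have "continuous_on {s..r} W" by (rule continuous_on_subset[OF W_cont]) (use r in auto)
  moreover have "continuous_on {s..r} (bubble n)"
    by (rule continuous_on_bubble[OF n])
  ultimately have F_cont: "continuous_on {s..r} F" unfolding F_def by (intro continuous_intros) auto
  have "S = {s..r} \<inter> F -` {..0}" by (auto simp: S_def)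
  then have "closed S"
    using continuous_closed_preimage[OF F_cont closed_real_atLeastAtMost closed_atMost] by metis
  moreover have "r \<in> S" using neg r by (auto simp: S_def F_def)
  moreover have "bdd_below S" by (rule bdd_belowI[of _ s]) (auto simp: S_def)
  ultimately have c: "Inf S \<in> S" using closed_contains_Inf by blast
  have before: "0 < F t" if "s \<le> t" "t < Inf S" for t
  proof (rule ccontr)
    assume "\<not> 0 < F t"
    then have "t \<in> S" using that c by (auto simp: S_def)
    then show False using cInf_lower[OF _ \<open>bdd_below S\<close>, of t] that by simp
  qed
  define c where "c = Inf S"
  have cS: "s \<le> c" "c \<le> r" "F c \<le> 0" using c by (auto simp: S_def c_def)
  have sA: "0 \<le> s * A" "0 \<le> e * A\<^sup>2" using s A e0 by auto
  \<comment> \<open>At \<open>s\<close> the difference is \<open>1 - bubble n s\<close>, already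
    below \<delta>, so the first contact comes strictly after \<open>s\<close>.\<close>
  have "\<delta> * 1 \<le> \<delta> * exp (pS (real n) * s\<^sup>2 / 2)" using \<delta> q by (intro mult_left_mono) auto
  then have "0 < F s" unfolding F_def W_s using small sA by simp
  then have "s < c" using cS by (cases "s = c") auto
  have "\<bar>W c - bubble n c\<bar> \<le> \<bar>1 - bubble n s\<bar> + s * c + e * c\<^sup>2 + \<delta> * exp (pS (real n) * c\<^sup>2 / 2) - \<delta>"
  proof (rule value_bound[OF \<delta> e L L_le \<open>s < c\<close>])
    show "\<bar>W t - bubble n t\<bar> \<le> \<delta> * exp (pS (real n) * t\<^sup>2 / 2)" if "s < t" "t < c" for t
      using before[of t] that by (simp add: c_def F_def)
  qed (use cS r in auto)
  moreover have "s * c \<le> s * A" using cS r s by (intro mult_left_mono) auto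
  moreover have "e * c\<^sup>2 \<le> e * A\<^sup>2" using cS r s e0 by (intro mult_left_mono power_mono) auto
  ultimately show False using cS small unfolding F_def by simp
qed

text \<open>The slope is divided by \<open>r\<close> because in this form it enters the Hessian of a
  radial function. The term (s/r)^n is the initial flux divided by r^n; the bound on the second
  derivative then follows by subtracting the two equations.\<close>

lemma derivatives_close_to_bubble:
  fixes \<delta> e L A r :: real
  assumes \<delta>: "0 < \<delta>" and e: "(pS (real n) - p) * L \<le> e" and L: "0 \<le> L"
    and L_le: "\<And>t. 0 \<le> t \<Longrightarrow> t \<le> A \<Longrightarrow> exp (-L) \<le> bubble n t"
    and small: "\<bar>1 - bubble n s\<bar> + s * A + e * A\<^sup>2 < \<delta>"
    and r: "s < r" "r < b" "r \<le> A"
  defines "K \<equiv> pS (real n) * \<delta> * exp (pS (real n) * A\<^sup>2 / 2) + e"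
  shows "\<bar>W r - bubble n r\<bar> \<le> \<delta> * exp (pS (real n) * A\<^sup>2 / 2)"
    and "\<bar>(W1 r - bubble' n r) / r\<bar> \<le> (s / r) ^ n + K"
    and "\<bar>W2 r - bubble'' n r\<bar> \<le> n * ((s / r) ^ n + K) + K"
proof -
  have q: "0 < pS (real n)" using p by simp
  have e0: "0 \<le> e" using e L p by (smt (verit) mult_nonneg_nonneg)
  have r0: "0 < r" using r s by simp
  have n0: "t ^ n = t * t ^ (n - 1)" for t :: real using n by (cases n) auto
  have D: "\<bar>W t - bubble n t\<bar> \<le> \<delta> * exp (pS (real n) * t\<^sup>2 / 2)" if "s \<le> t" "t \<le> r" for t
    using close_to_bubble[OF \<delta> e L L_le small, of t] that r by auto
  have mono: "\<delta> * exp (pS (real n) * r\<^sup>2 / 2) \<le> \<delta> * exp (pS (real n) * A\<^sup>2 / 2)"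
    using \<delta> q r0 r by (auto intro!: mult_left_mono power_mono divide_right_mono)
  show 1: "\<bar>W r - bubble n r\<bar> \<le> \<delta> * exp (pS (real n) * A\<^sup>2 / 2)"
    using D[of r] r mono by simp
  have K0: "pS (real n) * \<delta> * exp (pS (real n) * r\<^sup>2 / 2) + e \<le> K"
    unfolding K_def using mult_left_mono[OF mono, of "pS (real n)"] q by (simp add: mult.assoc)
  have Kn: "0 \<le> pS (real n) * \<delta> * exp (pS (real n) * r\<^sup>2 / 2) + e" using q \<delta> e0 by simp
  have "\<bar>r ^ (n - 1) * (W1 r - bubble' n r)\<bar>
      \<le> s ^ n / n + r ^ n / n * (pS (real n) * \<delta> * exp (pS (real n) * r\<^sup>2 / 2) + e)"
    by (rule flux_bound[OF \<delta> e L L_le r]) (use D r in auto)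
  also have "\<dots> \<le> s ^ n + r ^ n * K"
  proof (intro add_mono mult_mono)
    show "s ^ n / n \<le> s ^ n" "r ^ n / n \<le> r ^ n" using n s r0
      by (auto simp: divide_le_eq mult_le_cancel_left1)
  qed (use r0 K0 Kn in auto)
  also have "\<dots> = r ^ n * ((s / r) ^ n + K)" using r0 by (simp add: power_divide field_simps)
  also have "r ^ (n - 1) * (W1 r - bubble' n r) = r ^ n * ((W1 r - bubble' n r) / r)"
    unfolding n0[of r] using r0 by simp
  finally have "r ^ n * \<bar>(W1 r - bubble' n r) / r\<bar> \<le> r ^ n * ((s / r) ^ n + K)"
    using r0 by (simp add: abs_mult)
  then show 2: "\<bar>(W1 r - bubble' n r) / r\<bar> \<le> (s / r) ^ n + K"
    using r0 by (simp only: mult_le_cancel_left_pos zero_less_power)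
  have "\<bar>W r powr p - bubble n r powr pS (real n)\<bar>
      \<le> pS (real n) * \<bar>W r - bubble n r\<bar> + (pS (real n) - p) * L"
    using W_bounds[of r] L_le[of r] bubble_le_1[OF n, of r] r r0 p L by (intro powr_diff_le) auto
  also have "\<dots> \<le> pS (real n) * (\<delta> * exp (pS (real n) * A\<^sup>2 / 2)) + e"
    using 1 e q by (intro add_mono mult_left_mono) auto
  finally have 3: "\<bar>W r powr p - bubble n r powr pS (real n)\<bar> \<le> K" by (simp add: K_def mult.assoc)
  have "W2 r - bubble'' n r = - ((real n - 1) * ((W1 r - bubble' n r) / r))
      - (W r powr p - bubble n r powr pS (real n))"
    using r r0 by (simp add: ode bubble''_def field_simps)
  also have "\<bar>\<dots>\<bar> \<le> (real n - 1) * \<bar>(W1 r - bubble' n r) / r\<bar>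
      + \<bar>W r powr p - bubble n r powr pS (real n)\<bar>"
    using n by (intro order_trans[OF abs_triangle_ineq4]) (auto simp: abs_mult)
  also have "\<dots> \<le> n * ((s / r) ^ n + K) + K"
    using 2 3 n by (intro add_mono mult_mono) auto
  finally show "\<bar>W2 r - bubble'' n r\<bar> \<le> n * ((s / r) ^ n + K) + K" .
qed

end

section \<open>Energy of the radial equation\<close>

text \<open>For 1 < q < 2 the factor \<open>\<bar>y\<bar> powr (q - 2)\<close> is singular, but at y
  = 0 the convention \<open>0 powr a = 0\<close> makes the formula give the correct value 0.\<close>

lemma abs_powr_deriv:
  fixes q y :: real
  assumes "1 < q"
  shows "((\<lambda>y. \<bar>y\<bar> powr q) has_real_derivative q * (\<bar>y\<bar> powr (q - 2) * y)) (at y)"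
proof -
  consider "y > 0" | "y < 0" | "y = 0" by linarith
  then show ?thesis
  proof cases
    case 1
    have "((\<lambda>y. y powr q) has_real_derivative q * (y powr (q - 1))) (at y)"
      using 1 by (auto intro!: derivative_eq_intros)
    moreover have "y powr (q - 1) = y powr (q - 2) * y"
      using 1 powr_add[of y "q - 2" 1] by simp
    ultimately have "((\<lambda>y. y powr q) has_real_derivative q * (\<bar>y\<bar> powr (q - 2) * y)) (at y)"
      using 1 by simp
    then show ?thesis
      by (rule has_field_derivative_transform_within_open[where S = "{0<..}"]) (use 1 in auto)
  next
    case 2
    have "((\<lambda>y. (- y) powr q) has_real_derivative - (q * ((- y) powr (q - 1)))) (at y)"
      using 2 by (auto intro!: derivative_eq_intros)
    moreover have "(- y) powr (q - 1) = (- y) powr (q - 2) * (- y)"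
      using 2 powr_add[of "- y" "q - 2" 1] by simp
    ultimately have "((\<lambda>y. (- y) powr q) has_real_derivative q * (\<bar>y\<bar> powr (q - 2) * y)) (at y)"
      using 2 by simp
    then show ?thesis
      by (rule has_field_derivative_transform_within_open[where S = "{..<0}"]) (use 2 in auto)
  next
    case 3
    have "((\<lambda>h. \<bar>h\<bar> powr (q - 1)) \<longlongrightarrow> \<bar>0\<bar> powr (q - 1)) (at (0::real))"
      using assms by (intro tendsto_powr' tendsto_rabs tendsto_ident_at tendsto_const) auto
    then have "((\<lambda>h. \<bar>h\<bar> powr (q - 1)) \<longlongrightarrow> 0) (at (0::real))" by simp
    moreover have "\<forall>\<^sub>F h in at (0::real). norm (\<bar>h\<bar> powr q / h) \<le> \<bar>h\<bar> powr (q - 1)"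
      unfolding eventually_at_filter
    proof (rule always_eventually, intro allI impI)
      fix h :: real assume "h \<noteq> 0"
      then show "norm (\<bar>h\<bar> powr q / h) \<le> \<bar>h\<bar> powr (q - 1)"
        using powr_diff[of "\<bar>h\<bar>" q 1] by (simp add: abs_divide)
    qed
    ultimately have "((\<lambda>h. \<bar>h\<bar> powr q / h) \<longlongrightarrow> 0) (at 0)"
      by (rule Lim_null_comparison[rotated])
    then show ?thesis using 3 by (simp add: DERIV_def)
  qed
qed

text \<open>Bounds, uniform in \<open>p\<close>, for the Emden--Fowler variables \<open>Y\<close> and \<open>Z\<close> on orbits of energy at most 1.\<close>

definition orbit_bound :: "nat \<Rightarrow> real" where
  "orbit_bound n = (6 * (1 + (real n - 2)\<^sup>2 / 8)) powr ((real n - 2) / 2)"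

definition speed_bound :: "nat \<Rightarrow> real" where
  "speed_bound n = 3 + (real n - 2)\<^sup>2 / 4 * (orbit_bound n)\<^sup>2"

text \<open>The lower limit for \<open>p\<close> is the Serrin exponent n/(n-2), which says exactly
  that 2/(p-1) <= n-2. Derivatives are two-sided on (-1,1), since the profile is read off along a
  full diameter, while the equation is imposed for r > 0 only, because of its singular
  coefficient.\<close>

locale radial_ode =
  fixes n :: nat and p :: real and v v1 v2 :: "real \<Rightarrow> real"
  assumes n: "3 \<le> n" and p: "real n / (real n - 2) \<le> p" "p < pS (real n)"
    and v_deriv: "\<And>r. \<bar>r\<bar> < 1 \<Longrightarrow> (v has_real_derivative v1 r) (at r)"
    and v1_deriv: "\<And>r. \<bar>r\<bar> < 1 \<Longrightarrow> (v1 has_real_derivative v2 r) (at r)"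
    and v1_0: "v1 0 = 0" and v_0: "0 < v 0"
    and ode: "\<And>r. 0 < r \<Longrightarrow> r < 1 \<Longrightarrow>
      v2 r = - ((real n - 1) / r * v1 r) - \<bar>v r\<bar> powr (p - 1) * v r"
begin

text \<open>Emden--Fowler variables: in the time \<open>log r\<close>, \<open>Y = r powr \<alpha> * v\<close> has velocity \<open>Z\<close> and solves the
  autonomous equation \<open>Y'' = k Y' + \<gamma> Y - \<bar>Y\<bar> powr (p - 1) * Y\<close> with energy \<open>E\<close>. The (negative) friction
  \<open>k\<close> vanishes exactly at the critical exponent.\<close>

definition "\<alpha> = 2 / (p - 1)"
definition "k = 2 * \<alpha> - (real n - 2)"
definition "\<gamma> = \<alpha> * (real n - 2 - \<alpha>)"
definition "Y r = r powr \<alpha> * v r"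
definition "Z r = r powr \<alpha> * (\<alpha> * v r + r * v1 r)"
definition "E r = (Z r)\<^sup>2 / 2 - \<gamma> * (Y r)\<^sup>2 / 2 + \<bar>Y r\<bar> powr (p + 1) / (p + 1)"

section \<open>Admissible range of the exponents\<close>

lemma n2: "1 \<le> real n - 2" using n by simp

lemma p_minus_1: "2 / (real n - 2) \<le> p - 1"
proof -
  have "real n / (real n - 2) - 1 = 2 / (real n - 2)" using n2 by (simp add: field_simps)
  then show ?thesis using p by simp
qed

lemma p_gt_1: "1 < p"
proof -
  have "0 < 2 / (real n - 2)" using n2 by simp
  then show ?thesis using p_minus_1 by linarith
qed

lemma p_le_5: "p \<le> 5"
proof -
  have "pS (real n) \<le> 5" using n by (simp add: pS_def divide_le_eq)
  then show ?thesis using p by simp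
qed

lemma \<alpha>_pos: "0 < \<alpha>" using p_gt_1 by (simp add: \<alpha>_def)

lemma \<alpha>_le: "\<alpha> \<le> real n - 2"
  using p_minus_1 p_gt_1 n2 by (simp add: \<alpha>_def field_simps)

lemma \<alpha>_times: "\<alpha> * (p - 1) = 2" unfolding \<alpha>_def using p_gt_1 by (intro nonzero_eq_divide_eq[THEN iffD1]) auto

lemma k_pos: "0 < k"
proof -
  have "pS (real n) - 1 = 4 / (real n - 2)" using n2 by (simp add: pS_def field_simps)
  then have "p - 1 < 4 / (real n - 2)" using p by simp
  then have "(real n - 2) * (p - 1) < 4" using n2 by (simp add: field_simps)
  then have "real n - 2 < 4 / (p - 1)" using p_gt_1 by (simp add: field_simps)
  then show ?thesis by (simp add: k_def \<alpha>_def)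
qed

lemma \<gamma>_bounds: "0 \<le> \<gamma>" "\<gamma> \<le> (real n - 2)\<^sup>2 / 4"
proof -
  show "0 \<le> \<gamma>" using \<alpha>_pos \<alpha>_le by (simp add: \<gamma>_def)
  have "0 \<le> (\<alpha> - (real n - 2) / 2)\<^sup>2" by simp
  then show "\<gamma> \<le> (real n - 2)\<^sup>2 / 4" by (simp add: \<gamma>_def power2_eq_square field_simps)
qed

section \<open>The Emden--Fowler system and its energy identity\<close>

lemma Y_deriv:
  assumes "0 < r" "r < 1"
  shows "(Y has_real_derivative Z r / r) (at r)"
proof -
  have "(Y has_real_derivative (\<alpha> * r powr (\<alpha> - 1)) * v r + v1 r * r powr \<alpha>) (at r)"
    unfolding Y_def[abs_def]
    by (rule DERIV_mult[OF has_real_derivative_powr v_deriv]) (use assms in auto)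
  then show ?thesis
    using assms by (simp add: Z_def powr_diff field_simps)
qed

text \<open>Since \<alpha> (p-1) = 2, the power yields exactly the factor r^2 that balances two
  derivatives; this is what makes the equation for \<open>Y\<close> autonomous.\<close>

lemma abs_Y_powr: "0 < r \<Longrightarrow> \<bar>Y r\<bar> powr (p - 1) = r\<^sup>2 * \<bar>v r\<bar> powr (p - 1)"
proof -
  assume r: "0 < r"
  have "(r powr \<alpha>) powr (p - 1) = r powr 2" by (simp only: powr_powr \<alpha>_times)
  then show ?thesis using r by (simp add: Y_def abs_mult powr_mult)
qed

lemma Z_deriv:
  assumes "0 < r" "r < 1"
  shows "(Z has_real_derivative (k * Z r + \<gamma> * Y r - \<bar>Y r\<bar> powr (p - 1) * Y r) / r) (at r)"
proof -
  have "((\<lambda>r. \<alpha> * v r + r * v1 r) has_real_derivative \<alpha> * v1 r + (v1 r + r * v2 r)) (at r)"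
    by (rule derivative_eq_intros v_deriv v1_deriv refl | use assms in simp)+
  then have "(Z has_real_derivative (\<alpha> * r powr (\<alpha> - 1)) * (\<alpha> * v r + r * v1 r)
      + (\<alpha> * v1 r + (v1 r + r * v2 r)) * r powr \<alpha>) (at r)"
    unfolding Z_def[abs_def]
    by (intro DERIV_mult has_real_derivative_powr) (use assms in auto)
  moreover have "(\<alpha> * r powr (\<alpha> - 1)) * (\<alpha> * v r + r * v1 r)
      + (\<alpha> * v1 r + (v1 r + r * v2 r)) * r powr \<alpha>
      = (k * Z r + \<gamma> * Y r - \<bar>Y r\<bar> powr (p - 1) * Y r) / r"
  proof -
    define w where "w = \<bar>v r\<bar> powr (p - 1)"
    define x where "x = r powr \<alpha>"
    have x: "r powr (\<alpha> - 1) = x / r" using assms by (simp add: powr_diff x_def)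
    have Yr: "\<bar>Y r\<bar> powr (p - 1) * Y r = r\<^sup>2 * w * (x * v r)"
      unfolding abs_Y_powr[OF assms(1)] w_def x_def by (simp add: Y_def)
    show ?thesis
      unfolding Yr
      unfolding ode[OF assms] Y_def Z_def k_def \<gamma>_def x
        w_def[symmetric] x_def[symmetric]
      using assms by (simp add: field_simps power2_eq_square)
  qed
  ultimately show ?thesis by simp
qed

lemma E_deriv:
  assumes "0 < r" "r < 1"
  shows "(E has_real_derivative k * (Z r)\<^sup>2 / r) (at r)"
proof -
  have "((\<lambda>r. \<bar>Y r\<bar> powr (p + 1)) has_real_derivative
      (p + 1) * (\<bar>Y r\<bar> powr (p + 1 - 2) * Y r) * (Z r / r)) (at r)"
    using p_gt_1 by (intro DERIV_chain2[OF abs_powr_deriv Y_deriv] assms) simp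
  then have "((\<lambda>r. \<bar>Y r\<bar> powr (p + 1) / (p + 1)) has_real_derivative
      (p + 1) * (\<bar>Y r\<bar> powr (p + 1 - 2) * Y r) * (Z r / r) / (p + 1)) (at r)"
    by (rule DERIV_cdivide)
  moreover have "(p + 1) * (\<bar>Y r\<bar> powr (p + 1 - 2) * Y r) * (Z r / r) / (p + 1)
      = \<bar>Y r\<bar> powr (p - 1) * Y r * (Z r / r)"
    using p_gt_1 by simp
  ultimately have D: "((\<lambda>r. \<bar>Y r\<bar> powr (p + 1) / (p + 1)) has_real_derivative
      \<bar>Y r\<bar> powr (p - 1) * Y r * (Z r / r)) (at r)" by simp
  define Z' where "Z' = (k * Z r + \<gamma> * Y r - \<bar>Y r\<bar> powr (p - 1) * Y r) / r"
  have "((\<lambda>r. (Z r)\<^sup>2 / 2) has_real_derivative Z r * Z') (at r)"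
    using DERIV_cdivide[OF DERIV_power[OF Z_deriv[OF assms], of 2], of 2]
    unfolding Z'_def[symmetric] by (simp add: mult.commute)
  moreover have "((\<lambda>r. \<gamma> * (Y r)\<^sup>2 / 2) has_real_derivative \<gamma> * (Y r * (Z r / r))) (at r)"
    using DERIV_cdivide[OF DERIV_cmult[OF DERIV_power[OF Y_deriv[OF assms], of 2], of \<gamma>], of 2]
    by (simp add: mult.commute)
  ultimately have "(E has_real_derivative Z r * Z' - \<gamma> * (Y r * (Z r / r))
      + \<bar>Y r\<bar> powr (p - 1) * Y r * (Z r / r)) (at r)"
    unfolding E_def[abs_def] by (intro DERIV_add DERIV_diff D)
  moreover have "Z r * Z' - \<gamma> * (Y r * (Z r / r)) + \<bar>Y r\<bar> powr (p - 1) * Y r * (Z r / r)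
      = k * (Z r)\<^sup>2 / r"
    unfolding Z'_def using assms by (simp add: field_simps power2_eq_square)
  ultimately show ?thesis by simp
qed

lemma continuous_on_YZE:
  assumes "S \<subseteq> {0<..<1}"
  shows "continuous_on S Y" "continuous_on S Z" "continuous_on S E"
proof -
  have S: "0 < r" "r < 1" if "r \<in> S" for r using assms that by auto
  show "continuous_on S Y" by (rule DERIV_continuous_on) (use Y_deriv S has_field_derivative_at_within in blast)
  show "continuous_on S Z" by (rule DERIV_continuous_on) (use Z_deriv S has_field_derivative_at_within in blast)
  show "continuous_on S E" by (rule DERIV_continuous_on) (use E_deriv S has_field_derivative_at_within in blast)
qed

section \<open>Monotonicity and positivity of the energy\<close>

lemma E_mono:
  assumes "0 < r" "r \<le> t" "t < 1"
  shows "E r \<le> E t"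
proof (rule DERIV_nonneg_imp_nondecreasing[OF assms(2)])
  fix x assume "r \<le> x" "x \<le> t"
  then have x: "0 < x" "x < 1" using assms by auto
  then have "0 \<le> k * (Z x)\<^sup>2 / x" using k_pos by simp
  then show "\<exists>y. (E has_real_derivative y) (at x) \<and> 0 \<le> y" using E_deriv[OF x] by blast
qed

lemma YZE_limits:
  "(Y \<longlongrightarrow> 0) (at_right 0)" "(Z \<longlongrightarrow> 0) (at_right 0)" "(E \<longlongrightarrow> 0) (at_right 0)"
proof -
  have id: "((\<lambda>r::real. r) \<longlongrightarrow> 0) (at_right 0)" by (rule tendsto_ident_at)
  have v: "(v \<longlongrightarrow> v 0) (at_right 0)" "(v1 \<longlongrightarrow> v1 0) (at_right 0)"
    using DERIV_isCont[OF v_deriv[of 0]] DERIV_isCont[OF v1_deriv[of 0]]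
    by (auto simp: isCont_def intro: tendsto_within_subset)
  have a: "((\<lambda>r. r powr \<alpha>) \<longlongrightarrow> 0 powr \<alpha>) (at_right 0)"
    using \<alpha>_pos by (intro tendsto_powr' id tendsto_const) (auto simp: eventually_at_filter)
  have "(Y \<longlongrightarrow> 0 powr \<alpha> * v 0) (at_right 0)"
    unfolding Y_def[abs_def] by (intro tendsto_intros a v)
  then show Y: "(Y \<longlongrightarrow> 0) (at_right 0)" by simp
  have "(Z \<longlongrightarrow> 0 powr \<alpha> * (\<alpha> * v 0 + 0 * v1 0)) (at_right 0)"
    unfolding Z_def[abs_def] by (intro tendsto_intros a v id)
  then show Z: "(Z \<longlongrightarrow> 0) (at_right 0)" by simp
  have "((\<lambda>r. \<bar>Y r\<bar> powr (p + 1)) \<longlongrightarrow> \<bar>0\<bar> powr (p + 1)) (at_right 0)"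
    using p_gt_1 by (intro tendsto_powr' tendsto_rabs Y tendsto_const) auto
  then have "((\<lambda>r. \<bar>Y r\<bar> powr (p + 1)) \<longlongrightarrow> 0) (at_right 0)" by simp
  then have "(E \<longlongrightarrow> 0\<^sup>2 / 2 - \<gamma> * 0\<^sup>2 / 2 + 0 / (p + 1)) (at_right 0)"
    unfolding E_def[abs_def] using p_gt_1 by (intro tendsto_intros Y Z) auto
  then show "(E \<longlongrightarrow> 0) (at_right 0)" by simp
qed

lemma E_nonneg:
  assumes "0 < r" "r < 1"
  shows "0 \<le> E r"
proof (rule tendsto_le[OF _ tendsto_const YZE_limits(3)])
  show "\<forall>\<^sub>F x in at_right 0. E x \<le> E r"
    using eventually_at_right_real[OF assms(1)]
    by eventually_elim (use E_mono assms in auto)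
qed simp

text \<open>Near the origin \<open>Z\<close> behaves like \<alpha> v(0) r^\<alpha> > 0, so the
  energy grows strictly away from its limit 0. Strictness is what rules out double zeros and fixes
  the direction in which \<open>Y\<close> turns.\<close>

lemma E_pos:
  assumes "0 < r" "r < 1"
  shows "0 < E r"
proof -
  have "((\<lambda>r. \<alpha> * v r + r * v1 r) \<longlongrightarrow> \<alpha> * v 0 + 0 * v1 0) (at_right 0)"
  proof (intro tendsto_intros)
    show "(v \<longlongrightarrow> v 0) (at_right 0)" "(v1 \<longlongrightarrow> v1 0) (at_right 0)"
      using DERIV_isCont[OF v_deriv[of 0]] DERIV_isCont[OF v1_deriv[of 0]]
      by (auto simp: isCont_def intro: tendsto_within_subset)
  qed
  moreover have "0 < \<alpha> * v 0 + 0 * v1 0" using v_0 \<alpha>_pos by simp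
  ultimately have "\<forall>\<^sub>F x in at_right 0. 0 < \<alpha> * v x + x * v1 x"
    by (rule order_tendstoD)
  then obtain c where c: "0 < c" "\<And>x. 0 < x \<Longrightarrow> x < c \<Longrightarrow> 0 < \<alpha> * v x + x * v1 x"
    by (auto simp: eventually_at_right_field)
  define b where "b = min (c / 2) r"
  have b: "0 < b" "b < c" "b \<le> r" using c assms by (auto simp: b_def)
  have "E (b / 2) < E b"
  proof (rule DERIV_pos_imp_increasing[where f = E])
    show "b / 2 < b" using b by simp
    fix x assume x: "b / 2 \<le> x" "x \<le> b"
    then have "0 < x" "x < 1" "x < c" using b assms by auto
    then have "0 < Z x" using c by (simp add: Z_def)
    then have "0 < k * (Z x)\<^sup>2 / x" using k_pos \<open>0 < x\<close> by simp
    then show "\<exists>y. (E has_real_derivative y) (at x) \<and> 0 < y"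
      using E_deriv \<open>0 < x\<close> \<open>x < 1\<close> by blast
  qed
  then show ?thesis using E_nonneg[of "b / 2"] E_mono[of b r] b assms by simp
qed

text \<open>At a double zero \<open>Y\<close> and \<open>Z\<close> would both vanish, and hence the
  energy.\<close>

lemma simple_zero:
  assumes "0 < r" "r < 1" "v r = 0"
  shows "v1 r \<noteq> 0"
  using E_pos[OF assms(1,2)] assms(3) by (auto simp: E_def Y_def Z_def)

text \<open>On a sublevel set of the energy the superquadratic term controls the quadratic one; the
  care goes into keeping the constants free of \<open>p\<close>.\<close>

lemma orbit_bounds:
  assumes "0 < r" "r < 1" "E r \<le> 1"
  shows "\<bar>Y r\<bar> \<le> orbit_bound n" "\<bar>Z r\<bar> \<le> speed_bound n"
proof -
  define G where "G = 6 * (1 + (real n - 2)\<^sup>2 / 8)"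
  have G1: "1 \<le> G" by (simp add: G_def)
  have split: "\<bar>Y r\<bar> powr (p + 1) = \<bar>Y r\<bar> powr (p - 1) * (Y r)\<^sup>2"
    using powr_add[of "\<bar>Y r\<bar>" "p - 1" 2] by (cases "Y r = 0") (auto simp: add.commute)
  show Y: "\<bar>Y r\<bar> \<le> orbit_bound n"
  proof (cases "\<bar>Y r\<bar> \<le> 1")
    case True
    moreover have "1 \<le> G powr ((real n - 2) / 2)" using G1 n2 by (intro ge_one_powr_ge_zero) auto
    ultimately show ?thesis by (simp add: orbit_bound_def G_def)
  next
    case False
    then have y1: "1 < \<bar>Y r\<bar>" by simp
    then have Y2: "1 \<le> (Y r)\<^sup>2" using abs_le_square_iff[of 1 "Y r"] by simp
    have "\<bar>Y r\<bar> powr (p + 1) / (p + 1) \<le> 1 + \<gamma> * (Y r)\<^sup>2 / 2"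
      using assms(3) unfolding E_def by (smt (verit) divide_nonneg_pos zero_le_power2)
    also have "\<dots> \<le> (1 + \<gamma> / 2) * (Y r)\<^sup>2" using Y2 by (simp add: algebra_simps)
    finally have "\<bar>Y r\<bar> powr (p - 1) / (p + 1) * (Y r)\<^sup>2 \<le> (1 + \<gamma> / 2) * (Y r)\<^sup>2" by (simp add: split)
    then have "\<bar>Y r\<bar> powr (p - 1) / (p + 1) \<le> 1 + \<gamma> / 2" by (rule mult_right_le_imp_le) (use y1 in auto)
    then have "\<bar>Y r\<bar> powr (p - 1) \<le> (p + 1) * (1 + \<gamma> / 2)" using p_gt_1 by (simp add: field_simps)
    \<comment> \<open>The 6 bounds p + 1, and (n-2)^2/8 bounds \<gamma>/2.\<close>
    also have "\<dots> \<le> G" unfolding G_def using p_le_5 p_gt_1 \<gamma>_bounds by (intro mult_mono) auto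
    finally have "\<bar>Y r\<bar> powr (p - 1) \<le> G" .
    \<comment> \<open>Since |Y| > 1, the exponent may be lowered to its smallest admissible value
      2/(n-2), which makes the root taken next independent of \<open>p\<close>.\<close>
    moreover have "\<bar>Y r\<bar> powr (2 / (real n - 2)) \<le> \<bar>Y r\<bar> powr (p - 1)"
      using p_minus_1 y1 by (intro powr_mono) auto
    ultimately have "(\<bar>Y r\<bar> powr (2 / (real n - 2))) powr ((real n - 2) / 2) \<le> G powr ((real n - 2) / 2)"
      using n2 by (intro powr_mono2) auto
    moreover have "2 / (real n - 2) * ((real n - 2) / 2) = 1" using n2 by (simp add: divide_simps)
    ultimately show ?thesis using y1 by (simp only: powr_powr orbit_bound_def G_def) simp
  qed
  have "(Z r)\<^sup>2 \<le> 2 + \<gamma> * (Y r)\<^sup>2"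
  proof -
    have "0 \<le> \<bar>Y r\<bar> powr (p + 1) / (p + 1)" using p_gt_1 by simp
    then show ?thesis using assms(3) unfolding E_def by linarith
  qed
  also have "\<gamma> * (Y r)\<^sup>2 \<le> (real n - 2)\<^sup>2 / 4 * (orbit_bound n)\<^sup>2"
  proof (intro mult_mono)
    show "(Y r)\<^sup>2 \<le> (orbit_bound n)\<^sup>2" using power_mono[OF Y, of 2] by simp
  qed (use \<gamma>_bounds in auto)
  finally have "(Z r)\<^sup>2 + 1 \<le> speed_bound n" by (simp add: speed_bound_def)
  moreover have "\<bar>Z r\<bar> \<le> (Z r)\<^sup>2 + 1"
    using sum_squares_bound[of "\<bar>Z r\<bar>" 1] abs_ge_zero[of "Z r"] by simp
  ultimately show "\<bar>Z r\<bar> \<le> speed_bound n" by simp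
qed

section \<open>Growth of the energy across nodal intervals\<close>

lemma speed_bound_pos: "0 < speed_bound n"
  unfolding speed_bound_def by (intro add_pos_nonneg) auto

text \<open>While \<open>Y\<close> is monotone, \<open>dE = k Z dY\<close> is bounded by \<open>k\<close> times the variation of \<open>Y\<close>.\<close>
lemma E_increment_monotone:
  assumes "0 < x" "x \<le> y" "y < 1" "E y \<le> 1" "\<tau> = 1 \<or> \<tau> = -1"
    and "\<And>t. x < t \<Longrightarrow> t < y \<Longrightarrow> 0 \<le> \<tau> * Z t"
  shows "E y - E x \<le> k * speed_bound n * (\<tau> * (Y y - Y x))"
proof -
  define h where "h t = k * speed_bound n * (\<tau> * Y t) - E t" for t
  have "h x \<le> h y"
  proof (rule DERIV_nonneg_imp_increasing_open[where f = h])
    show "x \<le> y" by fact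
    show "continuous_on {x..y} h"
      unfolding h_def using assms by (intro continuous_intros continuous_on_YZE) auto
    fix t assume t: "x < t" "t < y"
    then have t01: "0 < t" "t < 1" using assms by auto
    have "E t \<le> 1" using E_mono[of t y] t assms by simp
    then have "\<tau> * Z t \<le> speed_bound n" using orbit_bounds(2)[OF t01] assms(5) by auto
    then have "0 \<le> k * ((\<tau> * Z t) * (speed_bound n - \<tau> * Z t)) / t"
      using assms(6)[OF t] k_pos t01 by auto
    also have "\<dots> = k * speed_bound n * (\<tau> * (Z t / t)) - k * (Z t)\<^sup>2 / t"
      using assms(5) by (auto simp: algebra_simps power2_eq_square diff_divide_distrib)
    finally have "0 \<le> k * speed_bound n * (\<tau> * (Z t / t)) - k * (Z t)\<^sup>2 / t" .
    moreover have "(h has_real_derivative k * speed_bound n * (\<tau> * (Z t / t)) - k * (Z t)\<^sup>2 / t) (at t)"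
      unfolding h_def by (intro DERIV_diff DERIV_cmult Y_deriv E_deriv t01)
    ultimately show "\<exists>d. (h has_real_derivative d) (at t) \<and> 0 \<le> d" by blast
  qed
  then show ?thesis by (simp add: h_def algebra_simps)
qed

text \<open>At a turning point of \<open>Y\<close>, positivity of the energy forces \<open>\<bar>Y\<bar>\<close> beyond the equilibrium, so
  \<open>\<bar>Y\<bar>\<close> can only turn downwards.\<close>
lemma Z_stays_negative:
  assumes "0 < x" "x \<le> y" "y < 1" "\<sigma> = 1 \<or> \<sigma> = -1"
    and nonneg: "\<And>t. x \<le> t \<Longrightarrow> t \<le> y \<Longrightarrow> 0 \<le> \<sigma> * v t"
    and neg: "\<sigma> * Z x < 0"
  shows "\<sigma> * Z y < 0"
proof (rule ccontr)
  assume "\<not> \<sigma> * Z y < 0"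
  define S where "S = {x..y} \<inter> (\<lambda>t. \<sigma> * Z t) -` {0..}"
  have cont: "continuous_on {x..y} (\<lambda>t. \<sigma> * Z t)"
    using assms by (intro continuous_intros continuous_on_YZE) auto
  have "closed S" unfolding S_def
    by (rule continuous_closed_preimage[OF cont closed_real_atLeastAtMost closed_atLeast])
  moreover have "y \<in> S" using assms \<open>\<not> \<sigma> * Z y < 0\<close> by (auto simp: S_def)
  moreover have bdd: "bdd_below S" by (rule bdd_belowI[of _ x]) (auto simp: S_def)
  ultimately have cS: "Inf S \<in> S" using closed_contains_Inf by blast
  define c where "c = Inf S"
  have c: "x \<le> c" "c \<le> y" "0 \<le> \<sigma> * Z c" using cS by (auto simp: S_def c_def)
  have before: "\<sigma> * Z t < 0" if "x \<le> t" "t < c" for t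
  proof (rule ccontr)
    assume "\<not> \<sigma> * Z t < 0"
    then have "t \<in> S" using that c by (auto simp: S_def)
    then show False using cInf_lower[OF _ bdd, of t] that by (simp add: c_def)
  qed
  have xc: "x < c" using c neg by (cases "x = c") auto
  have c01: "0 < c" "c < 1" using c assms by auto
  have "\<sigma> * Z c \<le> 0"
  proof (rule tendsto_upperbound)
    show "((\<lambda>t. \<sigma> * Z t) \<longlongrightarrow> \<sigma> * Z c) (at_left c)"
      using DERIV_isCont[OF DERIV_cmult[OF Z_deriv[OF c01], of \<sigma>]]
      by (auto simp: isCont_def intro: tendsto_within_subset)
    show "\<forall>\<^sub>F t in at_left c. \<sigma> * Z t \<le> 0"
      using eventually_at_left_real[OF xc] by eventually_elim (use before in \<open>auto intro: less_imp_le\<close>)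
  qed simp
  then have Zc: "Z c = 0" using c assms(4) by auto
  have E: "\<gamma> * (Y c)\<^sup>2 / 2 < \<bar>Y c\<bar> powr (p + 1) / (p + 1)" using E_pos[OF c01] Zc by (simp add: E_def)
  then have Y0: "Y c \<noteq> 0" by auto
  have split: "\<bar>Y c\<bar> powr (p + 1) = \<bar>Y c\<bar> powr (p - 1) * (Y c)\<^sup>2"
    using powr_add[of "\<bar>Y c\<bar>" "p - 1" 2] Y0 by (auto simp: add.commute)
  have "\<gamma> / 2 < \<bar>Y c\<bar> powr (p - 1) / (p + 1)"
  proof -
    have "\<gamma> / 2 * (Y c)\<^sup>2 < \<bar>Y c\<bar> powr (p - 1) / (p + 1) * (Y c)\<^sup>2" using E by (simp add: split)
    then show ?thesis by (rule mult_right_less_imp_less) simp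
  qed
  then have "\<gamma> / 2 * (p + 1) < \<bar>Y c\<bar> powr (p - 1)" using p_gt_1 by (simp add: field_simps)
  \<comment> \<open>Since (p+1)/2 >= 1, positive energy at a turning point puts |Y|^(p-1) above
    \<gamma>.\<close>
  moreover have "\<gamma> / 2 * 2 \<le> \<gamma> / 2 * (p + 1)" using \<gamma>_bounds p_gt_1 by (intro mult_left_mono) auto
  ultimately have gt: "\<gamma> < \<bar>Y c\<bar> powr (p - 1)" by simp
  have "0 \<le> \<sigma> * Y c"
    using mult_left_mono[OF nonneg[OF c(1,2)], of "c powr \<alpha>"] by (simp add: Y_def mult.left_commute)
  then have "0 < \<sigma> * Y c" using Y0 assms(4) by (auto simp: less_le)
  then have "(\<gamma> - \<bar>Y c\<bar> powr (p - 1)) * (\<sigma> * Y c) / c < 0"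
    using gt c01 by (intro divide_neg_pos mult_neg_pos) auto
  \<comment> \<open>At \<open>Z c = 0\<close> the friction term drops out and \<sigma> Z has
    negative derivative, so it is positive just before \<open>c\<close>, contrary to
    \<open>before\<close>.\<close>
  moreover have "((\<lambda>t. \<sigma> * Z t) has_real_derivative (\<gamma> - \<bar>Y c\<bar> powr (p - 1)) * (\<sigma> * Y c) / c) (at c)"
    using DERIV_cmult[OF Z_deriv[OF c01], of \<sigma>] Zc by (simp add: algebra_simps)
  ultimately obtain d where d: "0 < d" "\<And>h. 0 < h \<Longrightarrow> h < d \<Longrightarrow> \<sigma> * Z c < \<sigma> * Z (c - h)"
    using DERIV_neg_dec_left[of "\<lambda>t. \<sigma> * Z t"] by metis
  define h where "h = min (d / 2) (c - x)"
  have "0 < h" "h < d" "h \<le> c - x" using d xc by (auto simp: h_def)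
  then show False using d(2)[of h] before[of "c - h"] Zc by simp
qed

text \<open>Since |Y| turns at most once, the interval splits at \<open>c\<close> into a rising and
  a falling stretch. Each has variation at most \<open>orbit_bound n\<close>, whence the factor
  2.\<close>

lemma E_increment:
  assumes "0 < x" "x \<le> y" "y < 1" "E y \<le> 1" "\<sigma> = 1 \<or> \<sigma> = -1"
    and nonneg: "\<And>t. x \<le> t \<Longrightarrow> t \<le> y \<Longrightarrow> 0 \<le> \<sigma> * v t"
  shows "E y - E x \<le> 2 * speed_bound n * orbit_bound n * k"
proof -
  have Yb: "0 \<le> \<sigma> * Y t" "\<sigma> * Y t \<le> orbit_bound n" if "x \<le> t" "t \<le> y" for t
  proof -
    show "0 \<le> \<sigma> * Y t"
      using mult_left_mono[OF nonneg[OF that], of "t powr \<alpha>"] by (simp add: Y_def mult.left_commute)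
    have "E t \<le> 1" using E_mono[of t y] that assms by simp
    then show "\<sigma> * Y t \<le> orbit_bound n" using orbit_bounds(1)[of t] that assms by auto
  qed
  \<comment> \<open>\<open>S\<close> collects the times at which |Y| falls. If there are none, the
    infimum would be meaningless, and the whole interval counts as rising.\<close>
  define S where "S = {t \<in> {x..y}. \<sigma> * Z t < 0}"
  define c where "c = (if S = {} then y else Inf S)"
  have bdd: "bdd_below S" by (rule bdd_belowI[of _ x]) (auto simp: S_def)
  have c: "x \<le> c" "c \<le> y"
  proof -
    show "x \<le> c"
    proof (cases "S = {}")
      case False
      then show ?thesis by (auto simp: c_def S_def intro: cInf_greatest)
    qed (simp add: c_def assms)
    show "c \<le> y"
    proof (cases "S = {}")
      case False
      then obtain t where "t \<in> S" by blast
      then show ?thesis using False cInf_lower[OF _ bdd, of t] by (auto simp: c_def S_def)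
    qed (simp add: c_def)
  qed
  have 1: "0 \<le> \<sigma> * Z t" if "x < t" "t < c" for t
  proof (rule ccontr)
    assume "\<not> ?thesis"
    then have "t \<in> S" using that c by (auto simp: S_def)
    then show False using that cInf_lower[OF _ bdd, of t] by (auto simp: c_def split: if_splits)
  qed
  have 2: "0 \<le> - \<sigma> * Z t" if "c < t" "t < y" for t
  proof -
    have "S \<noteq> {}" using that by (auto simp: c_def)
    then have "Inf S < t" using that by (simp add: c_def)
    then obtain t' where "t' \<in> S" "t' < t"
      using cInf_lessD[OF \<open>S \<noteq> {}\<close>] by blast
    then have "\<sigma> * Z t < 0"
      using Z_stays_negative[of t' t \<sigma>] nonneg that assms by (auto simp: S_def)
    then show ?thesis by simp
  qed
  have "E c - E x \<le> k * speed_bound n * (\<sigma> * (Y c - Y x))"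
    using 1 c assms E_mono[of c y] by (intro E_increment_monotone) auto
  moreover have "E y - E c \<le> k * speed_bound n * (- \<sigma> * (Y y - Y c))"
    using 2 c assms by (intro E_increment_monotone) auto
  ultimately have "E y - E x \<le> k * speed_bound n * (2 * (\<sigma> * Y c) - \<sigma> * Y x - \<sigma> * Y y)"
    by (simp add: algebra_simps)
  also have "\<dots> \<le> k * speed_bound n * (2 * orbit_bound n)"
    using Yb[of c] Yb[of x] Yb[of y] c assms k_pos speed_bound_pos by (intro mult_left_mono) auto
  finally show ?thesis by (simp add: algebra_simps)
qed

text \<open>Removes the hypothesis \<open>E y \<le> 1\<close> on which the orbit bounds rest. Were
  the energy to exceed its allowance, \<open>E_increment\<close> could be applied at an intermediate
  time with energy \<open>min (E y) 1\<close>, which is still at most 1 but already too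
  large.\<close>

lemma E_growth:
  assumes "0 < x" "x \<le> y" "y < 1" "\<sigma> = 1 \<or> \<sigma> = -1"
    and nonneg: "\<And>t. x \<le> t \<Longrightarrow> t \<le> y \<Longrightarrow> 0 \<le> \<sigma> * v t"
    and small: "E x + 2 * speed_bound n * orbit_bound n * k < 1"
  shows "E y \<le> E x + 2 * speed_bound n * orbit_bound n * k"
proof (rule ccontr)
  assume neg: "\<not> ?thesis"
  have "0 \<le> 2 * speed_bound n * orbit_bound n * k"
    using speed_bound_pos k_pos by (simp add: orbit_bound_def)
  then have "E x \<le> 1" using small by linarith
  then have "E x \<le> min (E y) 1" using E_mono[of x y] assms by simp
  moreover have "continuous_on {x..y} E" using assms by (intro continuous_on_YZE) auto
  ultimately obtain t where t: "x \<le> t" "t \<le> y" "E t = min (E y) 1"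
    using IVT'[of E x "min (E y) 1" y] assms by auto
  have "E t - E x \<le> 2 * speed_bound n * orbit_bound n * k"
    by (rule E_increment[where \<sigma> = \<sigma>]) (use t assms in auto)
  then show False using t neg small by (auto simp: min_def split: if_splits)
qed

text \<open>Every nodal interval costs the same amount, and \<open>small\<close> keeps the total
  below the threshold 1 that \<open>E_growth\<close> requires. The first interval is entered from
  radii \<open>x > 0\<close> tending to 0, where the energy has limit 0.\<close>

lemma E_bound:
  assumes R: "R 0 = 0" "\<And>i. i < m \<Longrightarrow> R i < R (Suc i)" "R m = (1::real)"
    and sign: "\<And>i r. i < m \<Longrightarrow> R i \<le> r \<Longrightarrow> r \<le> R (Suc i) \<Longrightarrow> 0 < r \<Longrightarrow> r < 1 \<Longrightarrow> 0 \<le> (-1) ^ i * v r"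
    and small: "real m * (2 * speed_bound n * orbit_bound n * k) < 1"
    and "i < m" "0 < r" "r < 1" "r \<le> R (Suc i)"
  shows "E r \<le> real (Suc i) * (2 * speed_bound n * orbit_bound n * k)"
  using assms(6-)
proof (induction i arbitrary: r)
  case 0
  define K where "K = 2 * speed_bound n * orbit_bound n * k"
  have K0: "0 \<le> K" using speed_bound_pos k_pos by (simp add: K_def orbit_bound_def)
  have K1: "K < 1"
  proof -
    have "1 * K \<le> real m * K" using 0 K0 by (intro mult_right_mono) auto
    then show ?thesis using small by (simp add: K_def)
  qed
  have "E r \<le> 0 + K"
  proof (rule tendsto_lowerbound)
    show "((\<lambda>x. E x + K) \<longlongrightarrow> 0 + K) (at_right 0)" by (intro tendsto_intros YZE_limits)
    have "\<forall>\<^sub>F x in at_right 0. E x < 1 - K"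
      using K1 by (intro order_tendstoD(2)[OF YZE_limits(3)]) simp
    with eventually_at_right_real[OF 0(2)]
    show "\<forall>\<^sub>F x in at_right 0. E r \<le> E x + K"
    proof eventually_elim
      case (elim x)
      show ?case unfolding K_def
        by (rule E_growth[where \<sigma> = 1])
          (use elim 0 sign[of 0] R(1) in \<open>auto simp: K_def\<close>)
    qed
  qed simp
  then show ?case by (simp add: K_def)
next
  case (Suc i)
  define K where "K = 2 * speed_bound n * orbit_bound n * k"
  have K0: "0 \<le> K" using speed_bound_pos k_pos by (simp add: K_def orbit_bound_def)
  have Rpos: "j \<le> m \<Longrightarrow> 0 < j \<Longrightarrow> 0 < R j" for j
  proof (induction j)
    case (Suc j)
    then show ?case using R(1) R(2)[of j] by (cases j) auto
  qed simp
  have "j \<le> m \<Longrightarrow> Suc i < j \<Longrightarrow> R (Suc i) < R j" for j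
  proof (induction j)
    case (Suc j)
    then show ?case using R(2)[of j] by (cases "Suc i < j") (auto simp: less_Suc_eq)
  qed simp
  then have Rlt: "R (Suc i) < 1" using Suc.prems R(3) by force
  have IH: "E x \<le> real (Suc i) * K" if "0 < x" "x \<le> R (Suc i)" for x
    unfolding K_def by (rule Suc.IH) (use that Rlt Suc.prems in auto)
  show ?case
  proof (cases "r \<le> R (Suc i)")
    case True
    then have "E r \<le> real (Suc i) * K" using IH Suc.prems by simp
    also have "\<dots> \<le> real (Suc (Suc i)) * K" using K0 by (intro mult_right_mono) auto
    finally show ?thesis by (simp add: K_def)
  next
    case False
    have "real (Suc (Suc i)) * K \<le> real m * K" using K0 Suc.prems by (intro mult_right_mono) auto
    then have K1: "real (Suc i) * K + K < 1" using small by (simp add: K_def algebra_simps)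
    have R0: "0 < R (Suc i)" using Rpos Suc.prems by simp
    have "E r \<le> E (R (Suc i)) + K"
      unfolding K_def
    proof (rule E_growth[where \<sigma> = "(-1) ^ Suc i"])
      show "E (R (Suc i)) + 2 * speed_bound n * orbit_bound n * k < 1"
        using IH[of "R (Suc i)"] R0 K1 by (simp add: K_def)
      show "0 \<le> (-1) ^ Suc i * v t" if "R (Suc i) \<le> t" "t \<le> r" for t
        using sign[of "Suc i" t] that Suc.prems R0 by auto
      show "(-1::real) ^ Suc i = 1 \<or> (-1::real) ^ Suc i = -1"
        using neg_one_even_power neg_one_odd_power by blast
    qed (use False R0 Suc.prems in auto)
    then show ?thesis using IH[of "R (Suc i)"] R0 by (simp add: K_def algebra_simps)
  qed
qed

text \<open>The left-hand side is |Y|^((p-1)/2), and at a critical point of \<open>v\<close> the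
  energy controls |Y|^(p+1). The exponent on the right is a lower bound for (p-1)/(2(p+1)) free of
  \<open>p\<close>, from p-1 >= 2/(n-2) and p+1 <= 6; as 6 B <= 1, lowering the exponent enlarges
  the power.\<close>

lemma turning_radius_bound:
  assumes "0 < r" "r < 1" "v1 r = 0" "E r \<le> B" "6 * B \<le> 1"
  shows "\<bar>v r\<bar> powr ((p - 1) / 2) * r \<le> (6 * B) powr (1 / (6 * (real n - 2)))"
proof -
  have Zr: "Z r = \<alpha> * Y r" using assms by (simp add: Z_def Y_def)
  have "0 \<le> \<alpha>\<^sup>2 - \<gamma>"
  proof -
    have "\<alpha>\<^sup>2 - \<gamma> = \<alpha> * k" by (simp add: \<gamma>_def k_def power2_eq_square algebra_simps)
    then show ?thesis using \<alpha>_pos k_pos by simp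
  qed
  then have "0 \<le> (\<alpha>\<^sup>2 - \<gamma>) * (Y r)\<^sup>2" by simp
  then have "\<bar>Y r\<bar> powr (p + 1) / (p + 1) \<le> B"
    using assms(4) unfolding E_def Zr by (simp add: algebra_simps power_mult_distrib)
  then have "\<bar>Y r\<bar> powr (p + 1) \<le> (p + 1) * B" using p_gt_1 by (simp add: field_simps)
  also have "\<dots> \<le> 6 * B"
    using p_le_5 E_pos[OF assms(1,2)] assms(4) by (intro mult_right_mono) auto
  finally have YB: "\<bar>Y r\<bar> powr (p + 1) \<le> 6 * B" .
  have "\<bar>v r\<bar> powr ((p - 1) / 2) * r = \<bar>Y r\<bar> powr ((p - 1) / 2)"
  proof -
    have "\<alpha> * ((p - 1) / 2) = 1" using \<alpha>_times by simp
    then have "(r powr \<alpha>) powr ((p - 1) / 2) = r"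
      using assms(1) by (simp only: powr_powr) simp
    then show ?thesis using assms(1) by (simp add: Y_def abs_mult powr_mult)
  qed
  also have "\<dots> = (\<bar>Y r\<bar> powr (p + 1)) powr ((p - 1) / (2 * (p + 1)))"
  proof -
    have "(p + 1) * ((p - 1) / (2 * (p + 1))) = (p - 1) / 2" using p_gt_1 by (simp add: divide_simps)
    then show ?thesis by (simp only: powr_powr)
  qed
  also have "\<dots> \<le> (6 * B) powr ((p - 1) / (2 * (p + 1)))"
    using YB p_gt_1 by (intro powr_mono2) auto
  also have "\<dots> \<le> (6 * B) powr (1 / (6 * (real n - 2)))"
  proof (rule powr_mono')
    have "1 / (6 * (real n - 2)) = (2 / (real n - 2)) / 12" using n2 by (simp add: divide_simps)
    also have "\<dots> \<le> (p - 1) / 12" using p_minus_1 by (intro divide_right_mono) auto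
    also have "\<dots> \<le> (p - 1) / (2 * (p + 1))" using p_gt_1 p_le_5 by (intro divide_left_mono) auto
    finally show "1 / (6 * (real n - 2)) \<le> (p - 1) / (2 * (p + 1))" .
    show "0 \<le> 6 * B" using YB by (smt (verit) powr_ge_zero)
  qed (use assms in auto)
  finally show ?thesis .
qed

end

section \<open>Calculus of radial functions\<close>

lemma norm_line_deriv:
  fixes x :: "real^'n::finite"
  assumes "x \<noteq> 0"
  shows "((\<lambda>t. norm (x + t *\<^sub>R axis i 1)) has_real_derivative x $ i / norm x) (at 0)"
proof -
  have "((\<lambda>t. norm (x + t *\<^sub>R axis i 1)) has_derivative
      (\<lambda>h. (h *\<^sub>R axis i 1) \<bullet> sgn (x + 0 *\<^sub>R axis i 1))) (at 0)"
  proof (rule has_derivative_compose[where g = norm and f = "\<lambda>t. x + t *\<^sub>R axis i 1"])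
    show "((\<lambda>t. x + t *\<^sub>R axis i 1) has_derivative (\<lambda>h. h *\<^sub>R axis i 1)) (at 0)"
      by (auto intro!: derivative_eq_intros)
    show "(norm has_derivative (\<lambda>y. y \<bullet> sgn (x + 0 *\<^sub>R axis i 1))) (at (x + 0 *\<^sub>R axis i 1))"
      using assms by (simp add: has_derivative_norm)
  qed
  moreover have "(\<lambda>h. (h *\<^sub>R axis i 1) \<bullet> sgn (x + 0 *\<^sub>R axis i 1)) = (*) (x $ i / norm x)"
    by (simp add: fun_eq_iff sgn_div_norm inner_axis' field_simps)
  ultimately show ?thesis unfolding has_field_derivative_def by metis
qed

lemma eventually_line_in_annulus:
  fixes x :: "real^'n::finite"
  assumes "a < norm x" "norm x < b"
  shows "\<forall>\<^sub>F t in nhds 0. a < norm (x + t *\<^sub>R axis i 1) \<and> norm (x + t *\<^sub>R axis i 1) < b"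
proof -
  have "((\<lambda>t. norm (x + t *\<^sub>R axis i 1)) \<longlongrightarrow> norm (x + 0 *\<^sub>R axis i 1)) (nhds 0)"
    by (intro tendsto_intros filterlim_ident)
  then show ?thesis
    using assms by (intro eventually_conj) (auto dest: order_tendstoD)
qed

text \<open>With \<open>a = 0\<close> the annulus is a punctured ball, so the formulas below stay
  off the origin, where \<open>v1 r / r\<close> has no meaning.\<close>

locale radial_function =
  fixes f :: "real^'n::finite \<Rightarrow> real" and v v1 v2 :: "real \<Rightarrow> real" and a b :: real
  assumes a: "0 \<le> a"
    and f_eq: "\<And>x. a < norm x \<Longrightarrow> norm x < b \<Longrightarrow> f x = v (norm x)"
    and v_deriv: "\<And>r. a < r \<Longrightarrow> r < b \<Longrightarrow> (v has_real_derivative v1 r) (at r)"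
    and v1_deriv: "\<And>r. a < r \<Longrightarrow> r < b \<Longrightarrow> (v1 has_real_derivative v2 r) (at r)"
begin

lemma pd_eq:
  assumes "a < norm x" "norm x < b"
  shows "pd i f x = v1 (norm x) / norm x * x $ i"
proof -
  have x: "x \<noteq> 0" using assms a by auto
  have "((\<lambda>t. v (norm (x + t *\<^sub>R axis i 1))) has_real_derivative v1 (norm x) * (x $ i / norm x)) (at 0)"
    using DERIV_chain2[OF _ norm_line_deriv[OF x], of v "v1 (norm x)"] v_deriv[OF assms] by simp
  then have "((\<lambda>t. f (x + t *\<^sub>R axis i 1)) has_real_derivative v1 (norm x) * (x $ i / norm x)) (at 0)"
    by (rule DERIV_cong_ev[OF refl eventually_mono[OF eventually_line_in_annulus[OF assms, of i]] refl, THEN iffD2, rotated])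
      (simp add: f_eq)
  then show ?thesis unfolding pd_def by (simp add: DERIV_imp_deriv)
qed

lemma pd_pd_eq:
  assumes "a < norm x" "norm x < b"
  shows "pd j (pd i f) x = (if i = j then v1 (norm x) / norm x else 0)
     + (v2 (norm x) - v1 (norm x) / norm x) * (x $ i * x $ j) / (norm x)\<^sup>2"
proof -
  have x: "x \<noteq> 0" using assms a by auto
  define r where "r = norm x"
  have r: "0 < r" using x by (simp add: r_def)
  have "((\<lambda>r. v1 r / r) has_real_derivative (v2 r - v1 r / r) / r) (at r)"
    using DERIV_divide[OF v1_deriv[OF assms] DERIV_ident] r by (simp add: r_def field_simps)
  then have "((\<lambda>t. v1 (norm (x + t *\<^sub>R axis j 1)) / norm (x + t *\<^sub>R axis j 1)) has_real_derivative
      (v2 r - v1 r / r) / r * (x $ j / norm x)) (at 0)"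
    by (intro DERIV_chain2[OF _ norm_line_deriv[OF x], of "\<lambda>r. v1 r / r"]) (simp add: r_def)
  moreover have "((\<lambda>t. (x + t *\<^sub>R axis j 1) $ i) has_real_derivative (if i = j then 1 else 0)) (at 0)"
    by (auto intro!: derivative_eq_intros simp: axis_def)
  ultimately have D: "((\<lambda>t. v1 (norm (x + t *\<^sub>R axis j 1)) / norm (x + t *\<^sub>R axis j 1) * (x + t *\<^sub>R axis j 1) $ i)
     has_real_derivative (v2 r - v1 r / r) / r * (x $ j / norm x) * (x + 0 *\<^sub>R axis j 1) $ i
     + (if i = j then 1 else 0) * (v1 (norm (x + 0 *\<^sub>R axis j 1)) / norm (x + 0 *\<^sub>R axis j 1))) (at 0)"
    by (rule DERIV_mult)
  have "((\<lambda>t. pd i f (x + t *\<^sub>R axis j 1)) has_real_derivative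
      (v2 r - v1 r / r) / r * (x $ j / norm x) * (x + 0 *\<^sub>R axis j 1) $ i
     + (if i = j then 1 else 0) * (v1 (norm (x + 0 *\<^sub>R axis j 1)) / norm (x + 0 *\<^sub>R axis j 1))) (at 0)"
    by (rule DERIV_cong_ev[OF refl eventually_mono[OF eventually_line_in_annulus[OF assms, of j]] refl, THEN iffD2, OF _ D])
      (simp add: pd_eq)
  then have "pd j (pd i f) x = (v2 r - v1 r / r) / r * (x $ j / norm x) * x $ i
     + (if i = j then 1 else 0) * (v1 r / r)"
    unfolding pd_def[of j "pd i f"] by (simp add: DERIV_imp_deriv r_def)
  then show ?thesis by (simp add: r_def power2_eq_square mult.commute)
qed

text \<open>Each second derivative costs e for the diagonal term v1/r and 2 e for the rank-one term,
  whose direction cosines have product at most 1. The factor \<open>A\<close> comes from writing a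
  first derivative as (v1/r) times a coordinate.\<close>

lemma C2_size_le:
  fixes e A :: real
  assumes "a < norm x" "norm x < b" "norm x \<le> A" "\<bar>v (norm x)\<bar> \<le> e"
    "\<bar>v1 (norm x) / norm x\<bar> \<le> e" "\<bar>v2 (norm x)\<bar> \<le> e"
  shows "\<bar>f x\<bar> + (\<Sum>i\<in>UNIV. \<bar>pd i f x\<bar>) + (\<Sum>i\<in>UNIV. \<Sum>j\<in>UNIV. \<bar>pd i (pd j f) x\<bar>)
    \<le> e + CARD('n) * (e * A) + CARD('n) * (CARD('n) * (3 * e))"
proof -
  have r: "0 < norm x" using assms a by auto
  have e: "0 \<le> e" using assms(4) by linarith
  have "\<bar>f x\<bar> \<le> e" using assms f_eq by simp
  moreover have "(\<Sum>i\<in>UNIV. \<bar>pd i f x\<bar>) \<le> of_nat (card (UNIV :: 'n set)) * (e * A)"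
  proof (rule sum_bounded_above)
    fix i
    have "\<bar>x $ i\<bar> \<le> A" using component_le_norm_cart[of x i] assms by simp
    then show "\<bar>pd i f x\<bar> \<le> e * A"
      unfolding pd_eq[OF assms(1,2)] abs_mult using assms e by (intro mult_mono) auto
  qed
  moreover have "(\<Sum>i\<in>UNIV. \<Sum>j\<in>UNIV. \<bar>pd i (pd j f) x\<bar>)
      \<le> of_nat (card (UNIV :: 'n set)) * (of_nat (card (UNIV :: 'n set)) * (3 * e))"
  proof (intro sum_bounded_above)
    fix i j
    have xx: "\<bar>x $ j * x $ i / (norm x)\<^sup>2\<bar> \<le> 1"
      using r component_le_norm_cart[of x i] component_le_norm_cart[of x j]
      by (simp add: abs_mult power2_eq_square mult_mono)
    have "\<bar>(v2 (norm x) - v1 (norm x) / norm x) * (x $ j * x $ i / (norm x)\<^sup>2)\<bar> \<le> (2 * e) * 1"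
      unfolding abs_mult[of "v2 (norm x) - v1 (norm x) / norm x"] using xx assms(5,6) e
      by (intro mult_mono) linarith+
    then have "\<bar>(v2 (norm x) - v1 (norm x) / norm x) * (x $ j * x $ i) / (norm x)\<^sup>2\<bar> \<le> 2 * e"
      by simp
    moreover have "\<bar>if j = i then v1 (norm x) / norm x else 0\<bar> \<le> e" using assms(5) e by auto
    ultimately show "\<bar>pd i (pd j f) x\<bar> \<le> 3 * e"
      unfolding pd_pd_eq[OF assms(1,2)] by (intro order_trans[OF abs_triangle_ineq]) simp
  qed
  ultimately show ?thesis by simp
qed

end

section \<open>Radial functions at the origin\<close>

lemma abs_filterlim_at_right: "filterlim (\<lambda>t::real. \<bar>t\<bar>) (at_right 0) (at 0)"
proof -
  have "((\<lambda>t::real. \<bar>t\<bar>) \<longlongrightarrow> \<bar>0\<bar>) (at 0)" by (intro tendsto_rabs tendsto_ident_at)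
  moreover have "\<forall>\<^sub>F t::real in at 0. \<bar>t\<bar> \<in> {0<..} \<and> \<bar>t\<bar> \<noteq> 0" by (simp add: eventually_at_filter)
  ultimately show ?thesis by (simp add: filterlim_at)
qed

text \<open>On a coordinate axis \<open>f\<close> equals v(|t|), so one-sided quotients determine
  its derivatives at the centre. The second derivative is supplied as the limit \<open>L\<close> of
  \<open>v1 r / r\<close>, because \<open>v2 0\<close> may carry a wrong value, as
  \<open>bubble''\<close> does.\<close>

locale radial_function_at_0 = radial_function f v v1 v2 0 b
  for f :: "real^'n::finite \<Rightarrow> real" and v v1 v2 :: "real \<Rightarrow> real" and b :: real +
  fixes L :: real
  assumes b: "0 < b" and f_0: "f 0 = v 0"
    and v_flat: "((\<lambda>r. (v r - v 0) / r) \<longlongrightarrow> 0) (at_right 0)"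
    and v1_quot: "((\<lambda>r. v1 r / r) \<longlongrightarrow> L) (at_right 0)"
begin

lemma pd_0: "pd i f 0 = 0"
proof -
  have q: "((\<lambda>t. (v \<bar>t\<bar> - v 0) / \<bar>t\<bar>) \<longlongrightarrow> 0) (at (0::real))"
    by (rule filterlim_compose[OF v_flat abs_filterlim_at_right])
  have "((\<lambda>t. (f (t *\<^sub>R axis i 1) - f 0) / t) \<longlongrightarrow> 0) (at 0)"
  proof (rule Lim_null_comparison)
    show "((\<lambda>t. \<bar>(v \<bar>t\<bar> - v 0) / \<bar>t\<bar>\<bar>) \<longlongrightarrow> 0) (at (0::real))"
      using tendsto_rabs[OF q] by simp
    have "\<forall>\<^sub>F t in at (0::real). \<bar>t\<bar> < b"
      using b by (auto simp: eventually_at dist_real_def)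
    moreover have "\<forall>\<^sub>F t in at (0::real). t \<noteq> 0" by (simp add: eventually_at_filter)
    ultimately show "\<forall>\<^sub>F t in at 0. norm ((f (t *\<^sub>R axis i 1) - f 0) / t) \<le> \<bar>(v \<bar>t\<bar> - v 0) / \<bar>t\<bar>\<bar>"
      by eventually_elim (simp add: f_eq f_0)
  qed
  then have "((\<lambda>t. f (0 + t *\<^sub>R axis i 1)) has_real_derivative 0) (at 0)"
    by (simp add: DERIV_def)
  then show ?thesis unfolding pd_def by (rule DERIV_imp_deriv)
qed

lemma pd_pd_0: "pd j (pd i f) 0 = (if i = j then L else 0)"
proof -
  have q: "((\<lambda>t. v1 \<bar>t\<bar> / \<bar>t\<bar>) \<longlongrightarrow> L) (at (0::real))"
    by (rule filterlim_compose[OF v1_quot abs_filterlim_at_right])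
  have "((\<lambda>t. v1 \<bar>t\<bar> / \<bar>t\<bar> * (if i = j then 1 else 0)) \<longlongrightarrow> L * (if i = j then 1 else 0)) (at (0::real))"
    by (intro tendsto_intros q)
  moreover have "\<forall>\<^sub>F t in at (0::real). v1 \<bar>t\<bar> / \<bar>t\<bar> * (if i = j then 1 else 0)
      = (pd i f (t *\<^sub>R axis j 1) - pd i f 0) / t"
  proof -
    have "\<forall>\<^sub>F t in at (0::real). \<bar>t\<bar> < b"
      using b by (auto simp: eventually_at dist_real_def)
    moreover have "\<forall>\<^sub>F t in at (0::real). t \<noteq> 0" by (simp add: eventually_at_filter)
    ultimately show ?thesis
      by eventually_elim (simp add: pd_eq pd_0, simp add: axis_def)
  qed
  ultimately have "((\<lambda>t. (pd i f (t *\<^sub>R axis j 1) - pd i f 0) / t) \<longlongrightarrow> L * (if i = j then 1 else 0)) (at 0)"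
    by (rule Lim_transform_eventually)
  then have "((\<lambda>t. pd i f (0 + t *\<^sub>R axis j 1)) has_real_derivative L * (if i = j then 1 else 0)) (at 0)"
    by (simp add: DERIV_def)
  then show ?thesis unfolding pd_def[of j "pd i f"] by (simp add: DERIV_imp_deriv)
qed

lemma C2_size_0_le:
  fixes e A :: real
  assumes "\<bar>v 0\<bar> \<le> e" "\<bar>L\<bar> \<le> e" "0 \<le> A"
  shows "\<bar>f 0\<bar> + (\<Sum>i\<in>UNIV. \<bar>pd i f 0\<bar>) + (\<Sum>i\<in>UNIV. \<Sum>j\<in>UNIV. \<bar>pd i (pd j f) 0\<bar>)
    \<le> e + CARD('n) * (e * A) + CARD('n) * (CARD('n) * (3 * e))"
proof -
  have e: "0 \<le> e" using assms(1) by linarith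
  have "(\<Sum>i\<in>UNIV. \<Sum>j\<in>UNIV. \<bar>pd i (pd j f) 0\<bar>)
      \<le> of_nat (card (UNIV :: 'n set)) * (of_nat (card (UNIV :: 'n set)) * (3 * e))"
    by (intro sum_bounded_above) (use assms e in \<open>auto simp: pd_pd_0\<close>)
  moreover have "0 \<le> CARD('n) * (e * A)" using e assms by simp
  ultimately show ?thesis unfolding f_0 pd_0 using assms(1) by simp
qed

end

section \<open>Nodal structure\<close>

context radial_ode
begin

text \<open>The mechanical energy \<open>h\<close>, taken in the original radius, is dissipated by
  the term with coefficient (n-1)/r, in contrast to \<open>E\<close>, which grows. Hence the maximum
  of the innermost region sits at radius 0.\<close>

lemma abs_le_v0:
  assumes "0 \<le> r" "r < 1"
  shows "\<bar>v r\<bar> \<le> v 0"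
proof -
  define h where "h t = (v1 t)\<^sup>2 / 2 + \<bar>v t\<bar> powr (p + 1) / (p + 1)" for t
  have h_deriv: "(h has_real_derivative v1 t * v2 t + \<bar>v t\<bar> powr (p - 1) * v t * v1 t) (at t)"
    if "\<bar>t\<bar> < 1" for t
  proof -
    have "((\<lambda>t. \<bar>v t\<bar> powr (p + 1)) has_real_derivative
        (p + 1) * (\<bar>v t\<bar> powr (p + 1 - 2) * v t) * v1 t) (at t)"
      using p_gt_1 by (intro DERIV_chain2[OF abs_powr_deriv v_deriv] that) simp
    then have "((\<lambda>t. \<bar>v t\<bar> powr (p + 1) / (p + 1)) has_real_derivative
        (p + 1) * (\<bar>v t\<bar> powr (p + 1 - 2) * v t) * v1 t / (p + 1)) (at t)"
      by (rule DERIV_cdivide)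
    moreover have "(p + 1) * (\<bar>v t\<bar> powr (p + 1 - 2) * v t) * v1 t / (p + 1)
        = \<bar>v t\<bar> powr (p - 1) * v t * v1 t"
      using p_gt_1 by simp
    moreover have "((\<lambda>t. (v1 t)\<^sup>2 / 2) has_real_derivative v1 t * v2 t) (at t)"
      using DERIV_cdivide[OF DERIV_power[OF v1_deriv[OF that], of 2], of 2] by (simp add: mult.commute)
    ultimately show ?thesis unfolding h_def by (intro DERIV_add) simp_all
  qed
  have "- h 0 \<le> - h r"
  proof (rule DERIV_nonneg_imp_increasing_open[where f = "\<lambda>t. - h t"])
    show "0 \<le> r" by fact
    have "continuous_on {0..r} h"
    proof (rule DERIV_continuous_on)
      fix t assume "t \<in> {0..r}"
      then show "(h has_real_derivative v1 t * v2 t + \<bar>v t\<bar> powr (p - 1) * v t * v1 t) (at t within {0..r})"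
        using assms by (intro has_field_derivative_at_within[OF h_deriv]) auto
    qed
    then show "continuous_on {0..r} (\<lambda>t. - h t)" by (rule continuous_on_minus)
    fix t assume t: "0 < t" "t < r"
    have "v1 t * v2 t + \<bar>v t\<bar> powr (p - 1) * v t * v1 t = - ((real n - 1) / t * (v1 t)\<^sup>2)"
      using t assms by (simp add: ode algebra_simps power2_eq_square)
    moreover have "0 \<le> (real n - 1) / t * (v1 t)\<^sup>2" using t n by simp
    ultimately show "\<exists>y. ((\<lambda>t. - h t) has_real_derivative y) (at t) \<and> 0 \<le> y"
      using DERIV_minus[OF h_deriv[of t]] t assms by force
  qed
  then have "h r \<le> h 0" by simp
  moreover have "\<bar>v r\<bar> powr (p + 1) / (p + 1) \<le> h r" unfolding h_def by simp
  moreover have "h 0 = (v 0) powr (p + 1) / (p + 1)" using v1_0 v_0 by (simp add: h_def)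
  ultimately have "\<bar>v r\<bar> powr (p + 1) / (p + 1) \<le> (v 0) powr (p + 1) / (p + 1)" by simp
  then have "\<bar>v r\<bar> powr (p + 1) \<le> (v 0) powr (p + 1)" using p_gt_1 by (simp add: divide_le_cancel)
  then show ?thesis
    using powr_less_mono2[of "p + 1" "v 0" "\<bar>v r\<bar>"] p_gt_1 v_0 by (cases "\<bar>v r\<bar> \<le> v 0") auto
qed

lemma continuous_on_v1: "S \<subseteq> {-1<..<1} \<Longrightarrow> continuous_on S v1"
proof -
  assume S: "S \<subseteq> {-1<..<1}"
  then have S': "\<bar>r\<bar> < 1" if "r \<in> S" for r using that by force
  show "continuous_on S v1"
    by (rule DERIV_continuous_on) (use v1_deriv S' has_field_derivative_at_within in blast)
qed

end

lemma same_sign_on_interval: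
  fixes f :: "real \<Rightarrow> real"
  assumes "continuous_on S f" "is_interval S" "\<And>t. t \<in> S \<Longrightarrow> f t \<noteq> 0" "x \<in> S" "y \<in> S" "0 < f x"
  shows "0 < f y"
proof (rule ccontr)
  assume "\<not> 0 < f y"
  then have fy: "f y \<le> 0" by simp
  have "connected (f ` S)"
    using assms(1,2) by (intro connected_continuous_image is_interval_connected)
  then have "is_interval (f ` S)" by (simp add: is_interval_connected_1)
  moreover have "f x \<in> f ` S" "f y \<in> f ` S" using assms by auto
  ultimately have "0 \<in> f ` S"
    using fy assms(6) unfolding is_interval_1 by (meson less_imp_le)
  then show False using assms(3) by force
qed

locale nodal_solution =
  fixes u :: "real^'n::finite \<Rightarrow> real" and m :: nat and p :: real
  assumes dim: "3 \<le> CARD('n)" and m: "1 \<le> m"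
    and p_range: "real CARD('n) / (real CARD('n) - 2) \<le> p" "p < pS (real CARD('n))"
    and sol: "radial_sol m p u"
begin

lemma sol_C2: "C2_on (ball 0 1) u"
  and sol_cont: "continuous_on (cball 0 1) u"
  and sol_pde: "\<forall>x\<in>ball 0 1. - laplacian u x = \<bar>u x\<bar> powr (p - 1) * u x"
  and sol_boundary: "\<forall>x. norm x = 1 \<longrightarrow> u x = 0"
  and sol_radial: "\<forall>x\<in>cball 0 1. \<forall>y\<in>cball 0 1. norm x = norm y \<longrightarrow> u x = u y"
  and sol_finite: "finite (components {x\<in>ball 0 1. u x \<noteq> 0})"
  and sol_card: "card (components {x\<in>ball 0 1. u x \<noteq> 0}) = m"
  and sol_0: "u 0 > 0"
  using sol unfolding radial_sol_def by blast+

section \<open>The radial profile of a solution and its equation\<close>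

definition e :: "real^'n" where "e = axis (SOME i. True) 1"

text \<open>Taken along a whole line through the origin, so that the profile is differentiable at 0
  in the two-sided sense and its evenness yields \<open>v1 0 = 0\<close>.\<close>

definition v :: "real \<Rightarrow> real" where "v r = u (r *\<^sub>R e)"

lemma norm_e [simp]: "norm e = 1" by (simp add: e_def)

lemma u_eq:
  assumes "norm x \<le> 1"
  shows "u x = v (norm x)"
proof -
  have "x \<in> cball 0 1" "norm x *\<^sub>R e \<in> cball 0 1" using assms by auto
  moreover have "norm x = norm (norm x *\<^sub>R e)" by simp
  ultimately show ?thesis unfolding v_def using sol_radial by blast
qed

lemma v_even: "\<bar>r\<bar> \<le> 1 \<Longrightarrow> v r = v \<bar>r\<bar>"
  using u_eq[of "r *\<^sub>R e"] by (simp add: v_def)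

lemma v_0_pos: "0 < v 0"
  using sol_0 by (simp add: v_def)

lemma v_1: "v 1 = 0"
  using sol_boundary by (simp add: v_def)

lemma v_cont: "continuous_on {0..1} v"
proof -
  show ?thesis unfolding v_def
    by (rule continuous_on_compose2[OF sol_cont]) (auto intro!: continuous_intros)
qed

lemma profile_derivatives:
  obtains v1 v2 where "\<And>r. \<bar>r\<bar> < 1 \<Longrightarrow> (v has_real_derivative v1 r) (at r)"
    "\<And>r. \<bar>r\<bar> < 1 \<Longrightarrow> (v1 has_real_derivative v2 r) (at r)"
proof -
  obtain f' :: "(real^'n) \<Rightarrow> ((real^'n) \<Rightarrow>\<^sub>L real)" and f'' where
    f': "\<And>x. norm x < 1 \<Longrightarrow> (u has_derivative blinfun_apply (f' x)) (at x)" and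
    f'': "\<And>x. norm x < 1 \<Longrightarrow> (f' has_derivative blinfun_apply (f'' x)) (at x)"
    using sol_C2 unfolding C2_on_def by (metis mem_ball_0)
  have line: "((\<lambda>r. r *\<^sub>R e) has_derivative (\<lambda>h. h *\<^sub>R e)) (at r)" for r
    by (auto intro!: derivative_eq_intros)
  show thesis
  proof (rule that[of "\<lambda>r. f' (r *\<^sub>R e) e" "\<lambda>r. f'' (r *\<^sub>R e) e e"])
    fix r :: real assume r: "\<bar>r\<bar> < 1"
    have "(v has_derivative (\<lambda>h. f' (r *\<^sub>R e) (h *\<^sub>R e))) (at r)"
      unfolding v_def[abs_def] by (rule has_derivative_compose[OF line f']) (use r in simp)
    moreover have "(\<lambda>h. f' (r *\<^sub>R e) (h *\<^sub>R e)) = (*) (f' (r *\<^sub>R e) e)"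
      by (simp add: fun_eq_iff blinfun.scaleR_right)
    ultimately show "(v has_real_derivative f' (r *\<^sub>R e) e) (at r)"
      unfolding has_field_derivative_def by metis
    have "((\<lambda>r. f' (r *\<^sub>R e)) has_derivative (\<lambda>h. f'' (r *\<^sub>R e) (h *\<^sub>R e))) (at r)"
      by (rule has_derivative_compose[OF line f'']) (use r in simp)
    then have "((\<lambda>r. f' (r *\<^sub>R e) e) has_derivative (\<lambda>h. f'' (r *\<^sub>R e) (h *\<^sub>R e) e)) (at r)"
      by (rule bounded_linear.has_derivative[OF blinfun.bounded_linear_left])
    moreover have "(\<lambda>h. f'' (r *\<^sub>R e) (h *\<^sub>R e) e) = (*) (f'' (r *\<^sub>R e) e e)"
      by (simp add: fun_eq_iff blinfun.scaleR_right blinfun.scaleR_left)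
    ultimately show "((\<lambda>r. f' (r *\<^sub>R e) e) has_real_derivative f'' (r *\<^sub>R e) e e) (at r)"
      unfolding has_field_derivative_def by metis
  qed
qed

lemma profile_ode:
  obtains v1 v2 where "radial_ode CARD('n) p v v1 v2"
proof -
  obtain v1 v2 where D: "\<And>r. \<bar>r\<bar> < 1 \<Longrightarrow> (v has_real_derivative v1 r) (at r)"
    "\<And>r. \<bar>r\<bar> < 1 \<Longrightarrow> (v1 has_real_derivative v2 r) (at r)"
    by (rule profile_derivatives) blast
  interpret radial_function u v v1 v2 0 1
    by standard (use D in \<open>auto simp: u_eq\<close>)
  have "radial_ode CARD('n) p v v1 v2"
  proof
    show "v1 0 = 0"
    proof -
      have "((\<lambda>r. v (- r)) has_real_derivative - v1 0) (at 0)"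
        using DERIV_chain2[of v "v1 0" uminus 0 "-1" UNIV] D(1)[of 0] DERIV_minus[OF DERIV_ident, of 0 UNIV]
        by simp
      then have "(v has_real_derivative - v1 0) (at 0)"
      proof (rule has_field_derivative_transform_within_open[where S = "{-1<..<1}"])
        fix r :: real assume "r \<in> {-1<..<1}"
        then show "v (- r) = v r" using v_even[of r] v_even[of "- r"] by auto
      qed auto
      then have "v1 0 = - v1 0" by (intro DERIV_unique[OF D(1)]) simp_all
      then show ?thesis by simp
    qed
    fix r :: real assume r: "0 < r" "r < 1"
    \<comment> \<open>The coefficient of the rank-one part of the Hessian. It is also the trace of
      that part, because \<open>e\<close> has norm 1.\<close>
    define c where "c = v2 r - v1 r / r"
    have "pd i (pd i u) (r *\<^sub>R e) = v1 r / r + c * (e $ i * e $ i)" for i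
      using r pd_pd_eq[of "r *\<^sub>R e" i i] by (simp add: c_def power2_eq_square)
    then have "laplacian u (r *\<^sub>R e) = (\<Sum>i\<in>UNIV. v1 r / r + c * (e $ i * e $ i))"
      unfolding laplacian_def by simp
    also have "\<dots> = real CARD('n) * (v1 r / r) + c * (e \<bullet> e)"
      by (simp add: sum.distrib sum_distrib_left[symmetric] inner_vec_def)
    also have "e \<bullet> e = 1" by (simp flip: power2_norm_eq_inner)
    finally have "laplacian u (r *\<^sub>R e) = (real CARD('n) - 1) / r * v1 r + v2 r"
      by (simp add: c_def algebra_simps diff_divide_distrib)
    moreover have "- laplacian u (r *\<^sub>R e) = \<bar>u (r *\<^sub>R e)\<bar> powr (p - 1) * u (r *\<^sub>R e)"
      using sol_pde r by simp
    ultimately show "v2 r = - ((real CARD('n) - 1) / r * v1 r) - \<bar>v r\<bar> powr (p - 1) * v r"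
      by (simp add: v_def)
  qed (use dim p_range D v_0_pos in auto)
  then show thesis by (rule that)
qed

section \<open>Zeros of the profile\<close>

definition zeros :: "real set" where "zeros = {r. 0 < r \<and> r < 1 \<and> v r = 0}"

lemma zeros_eq: "{norm x |x. x \<in> ball 0 1 \<and> u x = 0} = zeros"
proof (intro equalityI subsetI)
  fix r assume "r \<in> {norm x |x. x \<in> ball 0 1 \<and> u x = 0}"
  then obtain x where x: "r = norm x" "norm x < 1" "u x = 0" by auto
  then have "v r = 0" using u_eq[of x] by simp
  then show "r \<in> zeros" using x v_0_pos by (cases "r = 0") (auto simp: zeros_def)
next
  fix r assume "r \<in> zeros"
  then show "r \<in> {norm x |x. x \<in> ball 0 1 \<and> u x = 0}"
    by (auto simp: zeros_def v_def intro!: exI[of _ "r *\<^sub>R e"])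
qed

abbreviation "support \<equiv> {x \<in> ball 0 1. u x \<noteq> 0}"

text \<open>The radii of a connected set form an interval, and by symmetry \<open>u\<close> vanishes
  on the whole sphere whose radius is in \<open>zeros\<close>.\<close>

lemma zero_separates:
  assumes "connected C" "C \<subseteq> support" "x \<in> C" "y \<in> C" "z \<in> zeros" "norm x \<le> z" "z \<le> norm y"
  shows False
proof -
  have "is_interval (norm ` C)"
    using assms(1) by (simp add: is_interval_connected_1 connected_continuous_image continuous_on_norm_id)
  then have "z \<in> norm ` C" using assms unfolding is_interval_1 by blast
  then show False using assms u_eq by (auto simp: zeros_def)
qed

text \<open>Finiteness is given for the components of the support and has to be carried over to the
  zeros, since \<open>sorted_list_of_set\<close> is meaningful for finite sets only. A simple zero
  is isolated, so just outside it a component is found; distinct zeros yield distinct components,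
  because the larger zero separates them.\<close>

lemma finite_zeros: "finite zeros"
proof -
  obtain v1 v2 where "radial_ode CARD('n) p v v1 v2" by (rule profile_ode)
  then interpret ode: radial_ode "CARD('n)" p v v1 v2 .
  have "\<exists>t. z < t \<and> t < 1 \<and> (\<forall>s. z < s \<and> s \<le> t \<longrightarrow> v s \<noteq> 0)" if "z \<in> zeros" for z
  proof -
    have z: "0 < z" "z < 1" "v z = 0" using that by (auto simp: zeros_def)
    have "((\<lambda>s. (v s - v z) / (s - z)) \<longlongrightarrow> v1 z) (at z)"
      using ode.v_deriv[of z] z by (simp add: has_field_derivative_iff)
    then have "\<forall>\<^sub>F s in at z. (v s - v z) / (s - z) \<noteq> 0"
      using ode.simple_zero[OF z] by (rule tendsto_imp_eventually_ne)
    then obtain d where d: "0 < d" "\<And>s. s \<noteq> z \<Longrightarrow> dist s z < d \<Longrightarrow> (v s - v z) / (s - z) \<noteq> 0"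
      by (auto simp: eventually_at)
    define t where "t = min (z + d / 2) ((z + 1) / 2)"
    have "z < t" "t < 1" "t < z + d" using d z by (auto simp: t_def min_def field_simps)
    moreover have "v s \<noteq> 0" if "z < s" "s \<le> t" for s
      using d(2)[of s] that \<open>t < z + d\<close> z by (auto simp: dist_real_def)
    ultimately show ?thesis by blast
  qed
  then obtain t where t: "\<And>z. z \<in> zeros \<Longrightarrow> z < t z" "\<And>z. z \<in> zeros \<Longrightarrow> t z < 1"
    "\<And>z s. z \<in> zeros \<Longrightarrow> z < s \<Longrightarrow> s \<le> t z \<Longrightarrow> v s \<noteq> 0" by metis
  define C where "C z = connected_component_set support (t z *\<^sub>R e)" for z
  have t0: "0 < t z" if "z \<in> zeros" for z using t(1)[OF that] that by (auto simp: zeros_def)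
  have in_support: "t z *\<^sub>R e \<in> support" if "z \<in> zeros" for z
    using t(2)[OF that] t(3)[OF that t(1)[OF that] order_refl] t0[OF that] by (simp add: v_def)
  have C_in: "t z *\<^sub>R e \<in> C z" if "z \<in> zeros" for z
    using in_support[OF that] unfolding C_def by (simp add: connected_component_refl_eq)
  have no_lt: False if "z \<in> zeros" "z' \<in> zeros" "C z = C z'" "z < z'" for z z'
  proof (rule zero_separates[OF _ _ C_in[OF that(1)] _ that(2)])
    show "connected (C z)" "C z \<subseteq> support"
      unfolding C_def by (rule connected_connected_component, rule connected_component_subset)
    show "t z' *\<^sub>R e \<in> C z" using C_in[OF that(2)] that(3) by simp
    have "\<not> z' \<le> t z" using t(3)[OF that(1,4)] that(2) by (auto simp: zeros_def)
    then show "norm (t z *\<^sub>R e) \<le> z'" using t0[OF that(1)] by simp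
    show "z' \<le> norm (t z' *\<^sub>R e)" using t(1)[OF that(2)] t0[OF that(2)] by simp
  qed
  have "inj_on C zeros"
    by (rule inj_onI, rule ccontr) (metis no_lt linorder_neqE_linordered_idom)
  moreover have "C ` zeros \<subseteq> components support"
    using in_support unfolding C_def components_def by blast
  ultimately show ?thesis by (intro finite_imageD[OF finite_subset[OF _ sol_finite]])
qed

section \<open>Nodal radii and the counting of components\<close>

definition "R i = (if i = 0 then 0 else if card zeros < i then 1 else sorted_list_of_set zeros ! (i - 1))"

lemma R_0: "R 0 = 0" by (simp add: R_def)

lemma R_last: "R (Suc (card zeros)) = 1" by (simp add: R_def)

lemma R_in_zeros: "0 < i \<Longrightarrow> i \<le> card zeros \<Longrightarrow> R i \<in> zeros"
  using nth_mem[of "i - 1" "sorted_list_of_set zeros"] finite_zeros by (simp add: R_def)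

lemma zeros_R:
  assumes "z \<in> zeros"
  obtains i where "0 < i" "i \<le> card zeros" "z = R i"
proof -
  have "z \<in> set (sorted_list_of_set zeros)" using assms finite_zeros by simp
  then obtain j where "j < card zeros" "z = sorted_list_of_set zeros ! j"
    by (metis in_set_conv_nth length_sorted_list_of_set)
  then show thesis by (intro that[of "Suc j"]) (auto simp: R_def)
qed

lemma R_Suc: "i \<le> card zeros \<Longrightarrow> R i < R (Suc i)"
proof -
  assume i: "i \<le> card zeros"
  consider "i = 0" "card zeros = 0" | "i = 0" "0 < card zeros" | "0 < i" "i = card zeros" | "0 < i" "i < card zeros"
    using i by linarith
  then show ?thesis
  proof cases
    case 4
    have "sorted_wrt (<) (sorted_list_of_set zeros)" by simp
    then have "sorted_list_of_set zeros ! (i - 1) < sorted_list_of_set zeros ! i"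
      by (rule sorted_wrt_nth_less) (use 4 finite_zeros in auto)
    then show ?thesis using 4 by (simp add: R_def)
  next
    case 2
    then have "0 < R 1" using R_in_zeros[of 1] by (simp add: zeros_def)
    then show ?thesis using 2 R_0 by simp
  next
    case 3
    then have "R i < 1" using R_in_zeros[of i] by (simp add: zeros_def)
    then show ?thesis using 3 R_last by simp
  qed (simp add: R_def)
qed

lemma R_mono: "i \<le> j \<Longrightarrow> j \<le> Suc (card zeros) \<Longrightarrow> R i \<le> R j"
proof (induction j)
  case (Suc j)
  then show ?case using R_Suc[of j] by (cases "i \<le> j") (auto simp: le_Suc_eq)
qed simp

lemma R_strict: "i < j \<Longrightarrow> j \<le> Suc (card zeros) \<Longrightarrow> R i < R j"
  using R_mono[of "Suc i" j] R_Suc[of i] by simp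

lemma R_bounds: "i \<le> Suc (card zeros) \<Longrightarrow> 0 \<le> R i \<and> R i \<le> 1"
  using R_mono[of 0 i] R_mono[of i "Suc (card zeros)"] by (simp add: R_0 R_last)

lemma v_nonzero_between:
  assumes "i \<le> card zeros" "R i < r" "r < R (Suc i)"
  shows "v r \<noteq> 0"
proof
  assume "v r = 0"
  then have "r \<in> zeros" using assms R_bounds[of i] R_bounds[of "Suc i"] by (auto simp: zeros_def)
  then obtain j where j: "0 < j" "j \<le> card zeros" "r = R j" by (rule zeros_R)
  then show False
    using assms R_mono[of j i] R_mono[of "Suc i" j] by (cases "j \<le> i") auto
qed

definition shell :: "nat \<Rightarrow> (real^'n) set" where
  "shell i = {x. (i = 0 \<or> R i < norm x) \<and> norm x < R (Suc i)}"

lemma shell_connected: "connected (shell i)"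
proof (cases "i = 0")
  case True
  then have "shell i = ball 0 (R 1)" by (auto simp: shell_def)
  then show ?thesis by simp
next
  case False
  then have "shell i = {x. R i < norm (x - 0) \<and> norm (x - 0) < R (Suc i)}" by (auto simp: shell_def)
  moreover have "2 \<le> DIM(real^'n)" using dim by simp
  ultimately show ?thesis by (simp only: connected_annulus(1))
qed

lemma shell_subset: "i \<le> card zeros \<Longrightarrow> shell i \<subseteq> support"
proof
  fix x assume i: "i \<le> card zeros" and x: "x \<in> shell i"
  have "norm x < 1" using x R_bounds[of "Suc i"] i by (auto simp: shell_def)
  moreover have "v (norm x) \<noteq> 0"
  proof (cases "x = 0")
    case False
    then have "R i < norm x" using x R_0 by (cases "i = 0") (auto simp: shell_def)
    then show ?thesis using v_nonzero_between[OF i] x by (auto simp: shell_def)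
  qed (use v_0_pos in simp)
  ultimately show "x \<in> support" using u_eq by auto
qed

lemma shell_cover:
  assumes "x \<in> support"
  obtains i where "i \<le> card zeros" "x \<in> shell i"
proof -
  define I where "I = {i. i \<le> card zeros \<and> R i \<le> norm x}"
  define i where "i = Max I"
  have fin: "finite I" by (simp add: I_def)
  have "0 \<in> I" by (simp add: I_def R_0)
  then have "i \<in> I" using Max_in[OF fin] unfolding i_def by blast
  then have i: "i \<le> card zeros" "R i \<le> norm x" by (auto simp: I_def)
  have "norm x < R (Suc i)"
  proof (rule ccontr)
    assume *: "\<not> ?thesis"
    have "norm x < 1" using assms by simp
    then have "Suc i \<le> card zeros" using * i R_last by (cases "i = card zeros") auto
    then have "Suc i \<in> I" using * by (simp add: I_def)
    then show False using Max_ge[OF fin, of "Suc i"] by (simp add: i_def)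
  qed
  moreover have "i = 0 \<or> R i \<noteq> norm x"
  proof (cases "i = 0")
    case False
    then have "R i \<in> zeros" using R_in_zeros i by simp
    then show ?thesis using assms u_eq by (auto simp: zeros_def)
  qed simp
  ultimately have "x \<in> shell i" using i by (auto simp: shell_def)
  then show thesis using that i by blast
qed

lemma shell_component:
  assumes "i \<le> card zeros" "x \<in> shell i"
  shows "connected_component_set support x = shell i"
proof (intro equalityI subsetI)
  show "y \<in> connected_component_set support x" if "y \<in> shell i" for y
    using connected_component_maximal[OF assms(2) shell_connected shell_subset[OF assms(1)]] that by blast
  fix y assume y: "y \<in> connected_component_set support x"
  then have yS: "y \<in> support" using connected_component_subset by blast
  have x: "x \<in> support" using shell_subset assms by blast
  have C: "connected (connected_component_set support x)" "connected_component_set support x \<subseteq> support"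
    by (rule connected_connected_component, rule connected_component_subset)
  have xC: "x \<in> connected_component_set support x" using x by (simp add: connected_component_refl_eq)
  have "norm y < R (Suc i)"
  proof (rule ccontr)
    assume *: "\<not> ?thesis"
    then have "i \<noteq> card zeros" using yS R_last by auto
    then have "R (Suc i) \<in> zeros" using R_in_zeros assms by simp
    moreover have "norm x \<le> R (Suc i)" using assms by (simp add: shell_def)
    ultimately show False by (rule zero_separates[OF C xC y]) (use * in simp)
  qed
  moreover have "R i < norm y" if "i \<noteq> 0"
  proof (rule ccontr)
    assume *: "\<not> ?thesis"
    have "R i \<in> zeros" using R_in_zeros assms that by simp
    then show False
      by (rule zero_separates[OF C y xC]) (use * assms that in \<open>simp_all add: shell_def\<close>)
  qed
  ultimately show "y \<in> shell i" by (auto simp: shell_def)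
qed

lemma shell_nonempty: 
  assumes "i \<le> card zeros" "R i < r" "r < R (Suc i)"
  shows "r *\<^sub>R e \<in> shell i"
  using assms R_bounds[of i] by (simp add: shell_def)

text \<open>The components are the shells cut out by the zero spheres, one more than there are
  zeros. Until this count is available \<open>R\<close> has to be indexed through
  \<open>card zeros\<close>; afterwards it agrees with \<open>nodal_radius\<close>.\<close>

lemma card_zeros: "Suc (card zeros) = m"
proof -
  have "components support = shell ` {..card zeros}"
  proof (intro equalityI subsetI)
    fix C assume "C \<in> components support"
    then obtain x where x: "x \<in> support" "C = connected_component_set support x"
      by (auto simp: components_def)
    obtain i where "i \<le> card zeros" "x \<in> shell i" by (rule shell_cover[OF x(1)])
    then show "C \<in> shell ` {..card zeros}" using shell_component x by auto
  next
    fix C assume "C \<in> shell ` {..card zeros}"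
    then obtain i where i: "i \<le> card zeros" "C = shell i" by auto
    obtain r where "R i < r" "r < R (Suc i)" using dense[OF R_Suc[OF i(1)]] by blast
    then have "r *\<^sub>R e \<in> shell i" using shell_nonempty i by blast
    then show "C \<in> components support"
      using shell_component[OF i(1)] shell_subset[OF i(1)] i(2) unfolding components_def by blast
  qed
  moreover have "inj_on shell {..card zeros}"
  proof (rule linorder_inj_onI)
    fix i j assume ij: "i < j" "i \<in> {..card zeros}" "j \<in> {..card zeros}"
    obtain r where r: "R j < r" "r < R (Suc j)" using dense[OF R_Suc[of j]] ij by auto
    have "r *\<^sub>R e \<in> shell j" using shell_nonempty r ij by simp
    moreover have "r *\<^sub>R e \<notin> shell i"
      using r R_mono[of "Suc i" j] R_bounds[of j] ij by (auto simp: shell_def)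
    ultimately show "shell i \<noteq> shell j" by blast
  qed auto
  ultimately have "card (components support) = Suc (card zeros)" by (simp add: card_image)
  then show ?thesis using sol_card by simp
qed

lemma nodal_radius_eq: "nodal_radius u m i = R i"
  unfolding nodal_radius_def R_def zeros_eq using card_zeros by auto

lemma nodal_region_eq: "nodal_region u m i = shell i"
  unfolding nodal_region_def shell_def nodal_radius_eq ..

section \<open>Signs and critical points of the profile\<close>

lemma v_R: "0 < i \<Longrightarrow> i \<le> m \<Longrightarrow> v (R i) = 0"
  using R_in_zeros[of i] v_1 R_last card_zeros by (cases "i = m") (auto simp: zeros_def)

text \<open>Induction across the zeros: the sign on the left gives the slope at the zero a weak
  sign, \<open>simple_zero\<close> makes it strict, so the profile changes sign there and keeps the
  new sign up to the next zero.\<close>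

lemma v_sign:
  assumes "i < m" "R i < r" "r < R (Suc i)"
  shows "0 < (-1) ^ i * v r"
  using assms
proof (induction i arbitrary: r)
  case 0
  have "0 < v r"
  proof (rule same_sign_on_interval[of "{0..<R 1}" v 0])
    show "continuous_on {0..<R 1} v"
      by (rule continuous_on_subset[OF v_cont]) (use R_bounds[of 1] in auto)
    show "v t \<noteq> 0" if "t \<in> {0..<R 1}" for t
      using v_nonzero_between[of 0 t] v_0_pos that R_0 by (cases "t = 0") auto
  qed (use 0 R_0 v_0_pos in \<open>auto simp: is_interval_co\<close>)
  then show ?case by simp
next
  case (Suc i)
  obtain v1 v2 where "radial_ode CARD('n) p v v1 v2" by (rule profile_ode)
  then interpret ode: radial_ode "CARD('n)" p v v1 v2 .
  define z where "z = R (Suc i)"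
  define f where "f t = (-1) ^ i * v t" for t
  have ic: "Suc i \<le> card zeros" using Suc.prems card_zeros by simp
  then have z: "z \<in> zeros" using R_in_zeros unfolding z_def by simp
  then have z': "0 < z" "z < 1" "v z = 0" by (auto simp: zeros_def)
  have fd: "(f has_real_derivative (-1) ^ i * v1 z) (at z)"
    unfolding f_def using z' by (intro DERIV_cmult ode.v_deriv) auto
  have left: "0 < f t" if "R i < t" "t < z" for t
    using Suc.IH[of t] that Suc.prems by (simp add: f_def z_def)
  have Rz: "R i < z" using R_Suc[of i] ic by (simp add: z_def)
  have "\<not> 0 < (-1) ^ i * v1 z"
  proof
    assume "0 < (-1) ^ i * v1 z"
    then obtain d where d: "0 < d" "\<And>h. 0 < h \<Longrightarrow> h < d \<Longrightarrow> f (z - h) < f z"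
      using DERIV_pos_inc_left[OF fd] by blast
    define h where "h = min (d / 2) ((z - R i) / 2)"
    have "0 < h" "h < d" "h < z - R i" using d Rz by (auto simp: h_def min_def)
    then show False using d(2)[of h] left[of "z - h"] z' by (simp add: f_def)
  qed
  moreover have "(-1) ^ i * v1 z \<noteq> 0" using ode.simple_zero[OF z'] by simp
  ultimately have "(-1) ^ i * v1 z < 0" by linarith
  then obtain d where d: "0 < d" "\<And>h. 0 < h \<Longrightarrow> h < d \<Longrightarrow> f (z + h) < f z"
    using DERIV_neg_dec_right[OF fd] by blast
  have Rz2: "z < R (Suc (Suc i))" using R_Suc[of "Suc i"] ic by (simp add: z_def)
  define h where "h = min (d / 2) ((R (Suc (Suc i)) - z) / 2)"
  have h: "0 < h" "h < d" "h < R (Suc (Suc i)) - z" using d Rz2 by (auto simp: h_def min_def)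
  have neg: "0 < - f (z + h)" using d(2)[OF h(1,2)] z' by (simp add: f_def)
  have "0 < - f r"
  proof (rule same_sign_on_interval[of "{z<..<R (Suc (Suc i))}" "\<lambda>t. - f t" "z + h"])
    have "continuous_on {z<..<R (Suc (Suc i))} v"
      by (rule continuous_on_subset[OF v_cont]) (use R_bounds[of "Suc (Suc i)"] ic z' in auto)
    then show "continuous_on {z<..<R (Suc (Suc i))} (\<lambda>t. - f t)"
      unfolding f_def by (intro continuous_intros)
    show "- f t \<noteq> 0" if "t \<in> {z<..<R (Suc (Suc i))}" for t
      using v_nonzero_between[OF ic, of t] that by (simp add: f_def z_def)
  qed (use h neg Suc.prems in \<open>auto simp: is_interval_oo z_def\<close>)
  then show ?case by (simp add: f_def)
qed

lemma v_sign_closed: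
  assumes "i < m" "R i \<le> r" "r \<le> R (Suc i)" "0 < r"
  shows "0 \<le> (-1) ^ i * v r"
proof -
  consider "R i < r" "r < R (Suc i)" | "r = R i" | "r = R (Suc i)" using assms by linarith
  then show ?thesis
  proof cases
    case 1
    then show ?thesis using v_sign[OF assms(1)] by (simp add: less_imp_le)
  next
    case 2
    then have "0 < i" using assms R_0 by (cases i) auto
    then show ?thesis using v_R[of i] 2 assms by simp
  next
    case 3
    then show ?thesis using v_R[of "Suc i"] assms by simp
  qed
qed

text \<open>In the innermost region the maximum is at the centre by \<open>abs_le_v0\<close>. In
  every other region the profile vanishes at both ends, which forces an interior maximum and hence a
  critical point.\<close>

lemma turning_point:
  assumes ode: "radial_ode CARD('n) p v v1 v2" and i: "i < m"
  obtains \<rho> where "R i \<le> \<rho>" "\<rho> < R (Suc i)" "i = 0 \<longleftrightarrow> \<rho> = 0" "v1 \<rho> = 0"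
    "0 < (-1) ^ i * v \<rho>" "nodal_max u m i = \<bar>v \<rho>\<bar>" "i \<noteq> 0 \<longrightarrow> R i < \<rho>"
    "\<And>r. R i \<le> r \<Longrightarrow> r \<le> R (Suc i) \<Longrightarrow> \<bar>v r\<bar> \<le> \<bar>v \<rho>\<bar>"
proof -
  interpret ode: radial_ode "CARD('n)" p v v1 v2 by fact
  have ic: "i \<le> card zeros" using i card_zeros by simp
  have R1: "0 \<le> R i" "R i < R (Suc i)" "R (Suc i) \<le> 1"
    using R_bounds[of i] R_bounds[of "Suc i"] R_Suc[OF ic] ic by auto
  have "\<exists>\<rho>. R i \<le> \<rho> \<and> \<rho> < R (Suc i) \<and> (i = 0 \<longleftrightarrow> \<rho> = 0) \<and> v1 \<rho> = 0 \<and> 0 < (-1) ^ i * v \<rho> \<and>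
      (i \<noteq> 0 \<longrightarrow> R i < \<rho>) \<and> (\<forall>r. R i \<le> r \<longrightarrow> r \<le> R (Suc i) \<longrightarrow> \<bar>v r\<bar> \<le> \<bar>v \<rho>\<bar>)"
  proof (cases "i = 0")
    case True
    have "\<bar>v r\<bar> \<le> \<bar>v 0\<bar>" if "0 \<le> r" "r \<le> R (Suc i)" for r
    proof (cases "r = 1")
      case False
      then show ?thesis using ode.abs_le_v0[of r] that R1 v_0_pos by simp
    qed (simp add: v_1)
    then show ?thesis using True R1 ode.v1_0 v_0_pos R_0 by (intro exI[of _ 0]) auto
  next
    case False
    define f where "f t = (-1) ^ i * v t" for t
    have "continuous_on {R i..R (Suc i)} f"
      unfolding f_def by (intro continuous_intros continuous_on_subset[OF v_cont]) (use R1 in auto)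
    then obtain \<rho> where \<rho>: "\<rho> \<in> {R i..R (Suc i)}" "\<And>t. t \<in> {R i..R (Suc i)} \<Longrightarrow> f t \<le> f \<rho>"
      using continuous_attains_sup[of "{R i..R (Suc i)}" f] R1 by auto
    obtain t where t: "R i < t" "t < R (Suc i)" using dense[OF R1(2)] by blast
    have pos: "0 < f \<rho>" using \<rho>(2)[of t] t v_sign[OF i t] by (simp add: f_def)
    have "f (R i) = 0" "f (R (Suc i)) = 0" using v_R[of i] v_R[of "Suc i"] False i by (auto simp: f_def)
    then have \<rho>': "R i < \<rho>" "\<rho> < R (Suc i)" using \<rho>(1) pos by (auto simp: less_le)
    have \<rho>01: "\<bar>\<rho>\<bar> < 1" using \<rho>' R1 by simp
    have "(-1) ^ i * v1 \<rho> = 0"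
    proof (rule DERIV_local_max)
      show "(f has_real_derivative (-1) ^ i * v1 \<rho>) (at \<rho>)"
        unfolding f_def by (intro DERIV_cmult ode.v_deriv \<rho>01)
      show "0 < min (\<rho> - R i) (R (Suc i) - \<rho>)" using \<rho>' by simp
      show "\<forall>y. \<bar>\<rho> - y\<bar> < min (\<rho> - R i) (R (Suc i) - \<rho>) \<longrightarrow> f y \<le> f \<rho>"
      proof (intro allI impI)
        fix y assume "\<bar>\<rho> - y\<bar> < min (\<rho> - R i) (R (Suc i) - \<rho>)"
        then have "y \<in> {R i..R (Suc i)}" by auto
        then show "f y \<le> f \<rho>" by (rule \<rho>(2))
      qed
    qed
    then have "v1 \<rho> = 0" by simp
    moreover have "\<bar>v r\<bar> \<le> \<bar>v \<rho>\<bar>" if "R i \<le> r" "r \<le> R (Suc i)" for r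
    proof -
      have "0 < R i" using R_in_zeros[of i] False ic by (simp add: zeros_def)
      then have "0 \<le> f r" unfolding f_def using v_sign_closed[OF i, of r] that by simp
      moreover have "f r \<le> f \<rho>" using \<rho>(2) that by simp
      ultimately have "\<bar>f r\<bar> \<le> \<bar>f \<rho>\<bar>" by simp
      then show ?thesis by (simp add: f_def abs_mult power_abs)
    qed
    ultimately show ?thesis using \<rho>' False R1 pos by (intro exI[of _ \<rho>]) (auto simp: f_def)
  qed
  then obtain \<rho> where \<rho>: "R i \<le> \<rho>" "\<rho> < R (Suc i)" "i = 0 \<longleftrightarrow> \<rho> = 0" "v1 \<rho> = 0"
    "0 < (-1) ^ i * v \<rho>" "i \<noteq> 0 \<longrightarrow> R i < \<rho>"
    "\<And>r. R i \<le> r \<Longrightarrow> r \<le> R (Suc i) \<Longrightarrow> \<bar>v r\<bar> \<le> \<bar>v \<rho>\<bar>" by blast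
  moreover have "nodal_max u m i = \<bar>v \<rho>\<bar>"
    unfolding nodal_max_def nodal_region_eq
  proof (rule cSup_eq_maximum)
    have "\<rho> *\<^sub>R e \<in> shell i" using \<rho> R1 by (auto simp: shell_def)
    moreover have "\<bar>u (\<rho> *\<^sub>R e)\<bar> = \<bar>v \<rho>\<bar>" by (simp add: v_def)
    ultimately show "\<bar>v \<rho>\<bar> \<in> (\<lambda>x. \<bar>u x\<bar>) ` shell i" by (metis image_eqI)
    fix y assume "y \<in> (\<lambda>x. \<bar>u x\<bar>) ` shell i"
    then obtain x where x: "x \<in> shell i" "y = \<bar>u x\<bar>" by blast
    have "R i \<le> norm x" using x R_0 by (cases "i = 0") (auto simp: shell_def)
    then show "y \<le> \<bar>v \<rho>\<bar>" using x \<rho>(7)[of "norm x"] u_eq[of x] R1 by (auto simp: shell_def)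
  qed
  ultimately show thesis using that by blast
qed

end

section \<open>Convergence\<close>

text \<open>The threshold \<open>\<eta>\<close> depends on \<open>n\<close>, \<open>A\<close>,
  \<open>\<delta>\<^sub>0\<close> and \<open>\<epsilon>\<close> only, not on the arc, so that a
  different arc may be inserted for each \<open>p\<close>. That the arc reaches beyond
  \<open>A\<close> is itself a consequence of closeness: \<open>W\<close> vanishes at
  \<open>b\<close>, the bubble nowhere.\<close>

lemma lane_emden_arc_converges:
  fixes A \<delta>\<^sub>0 \<epsilon> :: real
  assumes n: "3 \<le> n" and A: "0 < A" and \<delta>0: "0 < \<delta>\<^sub>0" and \<epsilon>: "0 < \<epsilon>"
  obtains \<eta> where "0 < \<eta>"
    "\<And>p s b W W1 W2. lane_emden_arc n p s b W W1 W2 \<Longrightarrow> pS (real n) - p < \<eta> \<Longrightarrow> s < \<eta> \<Longrightarrow>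
      continuous_on {s..b} W \<Longrightarrow> W b = 0 \<Longrightarrow> A < b \<and>
      (\<forall>r. s < r \<and> r \<le> A \<and> (s = 0 \<or> \<delta>\<^sub>0 \<le> r) \<longrightarrow> \<bar>W r - bubble n r\<bar> \<le> \<epsilon> \<and>
         \<bar>(W1 r - bubble' n r) / r\<bar> \<le> \<epsilon> \<and> \<bar>W2 r - bubble'' n r\<bar> \<le> \<epsilon>)"
proof -
  define q where "q = pS (real n)"
  have q1: "1 < q" using n by (simp add: q_def pS_def)
  define L where "L = - ln (bubble n A)"
  have L0: "0 \<le> L" using bubble_pos[OF n, of A] bubble_le_1[OF n, of A] A by (simp add: L_def)
  have L_le: "exp (- L) \<le> bubble n t" if "0 \<le> t" "t \<le> A" for t
    using bubble_pos[OF n, of A] bubble_antimono[OF n that] by (simp add: L_def)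
  \<comment> \<open>Kept below the least value of the bubble on [0, A], so that \<open>W\<close>
    cannot vanish there.\<close>
  define \<epsilon>' where "\<epsilon>' = min \<epsilon> (bubble n A / 2)"
  have \<epsilon>': "0 < \<epsilon>'" "\<epsilon>' \<le> \<epsilon>" "\<epsilon>' < bubble n A"
    using \<epsilon> bubble_pos[OF n, of A] by (auto simp: \<epsilon>'_def)
  define Bm where "Bm = exp (q * A\<^sup>2 / 2)"
  have Bm: "0 < Bm" by (simp add: Bm_def)
  define Q where "Q = q * Bm + 1"
  have "1 * Bm \<le> q * Bm" using Bm q1 by (intro mult_right_mono) auto
  then have "Bm \<le> Q" by (simp only: Q_def)
  moreover have "1 \<le> Q" using Bm q1 by (simp add: Q_def)
  ultimately have Q: "1 \<le> Q" "Bm \<le> Q" by auto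
  \<comment> \<open>Chosen so that the worst final bound, n (2 \<delta> Q) + \<delta> Q for the
    second derivative, equals \<open>\<epsilon>'\<close>.\<close>
  define \<delta> where "\<delta> = \<epsilon>' / ((2 * real n + 1) * Q)"
  have \<delta>: "0 < \<delta>" using \<epsilon>' Q by (simp add: \<delta>_def)
  have \<delta>Q: "(2 * real n + 1) * (\<delta> * Q) = \<epsilon>'" using Q by (simp add: \<delta>_def)
  \<comment> \<open>Makes \<open>e * A\<^sup>2\<close> at most a quarter of \<delta>; two further
    quarters go to \<open>s * A\<close> and to the deviation of \<open>bubble n s\<close> from
    1.\<close>
  define e where "e = \<delta> / (4 * (A\<^sup>2 + 1))"
  have A2: "0 < A\<^sup>2 + 1" by (intro add_nonneg_pos) auto
  have e: "0 < e" using \<delta> A2 by (simp add: e_def)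
  have e4: "e * (A\<^sup>2 + 1) = \<delta> / 4" using A2 by (simp add: e_def field_simps)
  then have eA: "e * A\<^sup>2 \<le> \<delta> / 4" "e \<le> \<delta>"
  proof -
    have "e * A\<^sup>2 + e = \<delta> / 4" using e4 by (simp add: algebra_simps)
    moreover have "0 \<le> e * A\<^sup>2" using e by simp
    ultimately show "e * A\<^sup>2 \<le> \<delta> / 4" "e \<le> \<delta>" using e \<delta> by linarith+
  qed
  have "isCont (bubble n) 0" using bubble_deriv[OF n] DERIV_isCont by blast
  then obtain \<eta>2 where \<eta>2: "0 < \<eta>2" "\<And>s. \<bar>s\<bar> < \<eta>2 \<Longrightarrow> \<bar>bubble n s - 1\<bar> < \<delta> / 4"
    using \<delta> bubble_0[OF n] unfolding continuous_at_eps_delta dist_real_def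
    by (metis diff_zero divide_pos_pos zero_less_numeral)
  \<comment> \<open>The entries ensure, in order: (pS - p) L <= e, \<open>bubble n s\<close> close
    to 1, \<open>s * A\<close> small, and s/r <= \<delta> for all r >=
    \<open>\<delta>\<^sub>0\<close>.\<close>
  define \<eta> where "\<eta> = min (e / (L + 1)) (min \<eta>2 (min (\<delta> / (4 * A)) (\<delta> * \<delta>\<^sub>0)))"
  have \<eta>: "0 < \<eta>" "\<eta> \<le> e / (L + 1)" "\<eta> \<le> \<eta>2" "\<eta> \<le> \<delta> / (4 * A)" "\<eta> \<le> \<delta> * \<delta>\<^sub>0"
    using e L0 \<eta>2 \<delta> A \<delta>0 by (auto simp: \<eta>_def)
  show thesis
  proof (rule that[OF \<eta>(1)])
    fix p s b W W1 W2
    assume arc: "lane_emden_arc n p s b W W1 W2" and close: "pS (real n) - p < \<eta>" "s < \<eta>"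
      and cont: "continuous_on {s..b} W" and Wb: "W b = 0"
    interpret lane_emden_arc n p s b W W1 W2 by (rule arc)
    have eL: "(pS (real n) - p) * L \<le> e"
    proof -
      have "pS (real n) - p \<le> e / (L + 1)" using close \<eta> by linarith
      then have "(pS (real n) - p) * (L + 1) \<le> e" using L0 by (simp add: field_simps)
      moreover have "(pS (real n) - p) * (L + 1) = (pS (real n) - p) * L + (pS (real n) - p)"
        by (simp add: algebra_simps)
      ultimately show ?thesis using p by linarith
    qed
    have small: "\<bar>1 - bubble n s\<bar> + s * A + e * A\<^sup>2 < \<delta>"
    proof -
      have "\<bar>bubble n s - 1\<bar> < \<delta> / 4" using \<eta>2(2)[of s] s close \<eta> by simp
      moreover have "s * A \<le> \<delta> / 4"
      proof -
        have "s \<le> \<delta> / (4 * A)" using close \<eta> by linarith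
        then show ?thesis using A by (simp add: field_simps)
      qed
      ultimately show ?thesis using eA \<delta> by linarith
    qed
    have K: "q * \<delta> * Bm + e \<le> \<delta> * Q" using eA by (simp add: Q_def algebra_simps)
    have \<delta>Q0: "0 \<le> \<delta> * Q" using \<delta> Q by simp
    have \<delta>Q1: "\<delta> * Q \<le> \<epsilon>'" "2 * (\<delta> * Q) \<le> \<epsilon>'" "real n * (2 * (\<delta> * Q)) + \<delta> * Q = \<epsilon>'"
    proof -
      show eq: "real n * (2 * (\<delta> * Q)) + \<delta> * Q = \<epsilon>'" using \<delta>Q by (simp add: algebra_simps)
      have "1 * (2 * (\<delta> * Q)) \<le> real n * (2 * (\<delta> * Q))" using n \<delta>Q0 by (intro mult_right_mono) auto
      then show "\<delta> * Q \<le> \<epsilon>'" "2 * (\<delta> * Q) \<le> \<epsilon>'" using eq \<delta>Q0 by linarith+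
    qed
    have close_value: "\<bar>W r - bubble n r\<bar> \<le> \<epsilon>'" if "s < r" "r < b" "r \<le> A" for r
    proof -
      have "\<bar>W r - bubble n r\<bar> \<le> \<delta> * exp (pS (real n) * A\<^sup>2 / 2)"
        by (rule derivatives_close_to_bubble(1)[OF \<delta> eL L0 L_le small that])
      also have "\<dots> = \<delta> * Bm" by (simp add: Bm_def q_def)
      also have "\<dots> \<le> \<delta> * Q" using Q \<delta> by simp
      finally show ?thesis using \<delta>Q1 by linarith
    qed
    have "A < b"
    proof (rule ccontr)
      assume "\<not> A < b"
      then have bA: "b \<le> A" by simp
      \<comment> \<open>The endpoint \<open>b\<close> lies outside the half-open arc, so the
        estimate is carried there by continuity.\<close>
      have "\<bar>W b - bubble n b\<bar> \<le> \<epsilon>'"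
      proof (rule tendsto_upperbound)
        have "continuous_on {s..b} (\<lambda>r. \<bar>W r - bubble n r\<bar>)"
          by (intro continuous_intros cont continuous_on_bubble n)
        then have "((\<lambda>r. \<bar>W r - bubble n r\<bar>) \<longlongrightarrow> \<bar>W b - bubble n b\<bar>) (at b within {s..b})"
          using s by (simp add: continuous_on)
        then show "((\<lambda>r. \<bar>W r - bubble n r\<bar>) \<longlongrightarrow> \<bar>W b - bubble n b\<bar>) (at_left b)"
          using s by (simp add: at_within_Icc_at_left)
        show "\<forall>\<^sub>F r in at_left b. \<bar>W r - bubble n r\<bar> \<le> \<epsilon>'"
          using eventually_at_left_real[OF s(2)]
          by (rule eventually_mono) (use close_value bA in auto)
      qed simp
      moreover have "bubble n A \<le> bubble n b" using bubble_antimono[OF n] bA s by simp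
      ultimately show False using Wb \<epsilon>' by simp
    qed
    moreover have "\<bar>W r - bubble n r\<bar> \<le> \<epsilon> \<and> \<bar>(W1 r - bubble' n r) / r\<bar> \<le> \<epsilon> \<and>
        \<bar>W2 r - bubble'' n r\<bar> \<le> \<epsilon>"
      if r: "s < r" "r \<le> A" "s = 0 \<or> \<delta>\<^sub>0 \<le> r" for r
    proof -
      have rb: "r < b" using r \<open>A < b\<close> by simp
      have r0: "0 < r" using r s by simp
      have "(s / r) ^ n \<le> \<delta> * Q"
      proof (cases "s = 0")
        case True
        then show ?thesis using n \<delta>Q0 by (simp add: power_0_left)
      next
        case False
        then have \<delta>r: "\<delta>\<^sub>0 \<le> r" using r by simp
        have "(s / r) ^ n \<le> (s / r) ^ 1" using r r0 s n by (intro power_decreasing) auto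
        also have "\<dots> \<le> s / \<delta>\<^sub>0" using \<delta>r \<delta>0 s by (simp add: frac_le)
        also have "\<dots> \<le> \<delta>" using close \<eta> \<delta>0 by (simp add: divide_le_eq)
        also have "\<dots> \<le> \<delta> * Q" using Q \<delta> by simp
        finally show ?thesis .
      qed
      then have g: "(s / r) ^ n + (q * \<delta> * Bm + e) \<le> 2 * (\<delta> * Q)" using K by linarith
      note D = derivatives_close_to_bubble[OF \<delta> eL L0 L_le small r(1) rb r(2)]
      have "\<bar>(W1 r - bubble' n r) / r\<bar> \<le> \<epsilon>"
        using D(2) g \<delta>Q1 \<epsilon>' by (simp add: Bm_def q_def)
      moreover have "\<bar>W2 r - bubble'' n r\<bar> \<le> \<epsilon>"
      proof -
        have "\<bar>W2 r - bubble'' n r\<bar> \<le> n * ((s / r) ^ n + (q * \<delta> * Bm + e)) + (q * \<delta> * Bm + e)"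
          using D(3) by (simp add: Bm_def q_def)
        also have "\<dots> \<le> n * (2 * (\<delta> * Q)) + \<delta> * Q"
          using g K by (intro add_mono mult_left_mono) auto
        finally show ?thesis using \<delta>Q1 \<epsilon>' by linarith
      qed
      ultimately show ?thesis using close_value[OF r(1) rb r(2)] \<epsilon>' by simp
    qed
    ultimately show "A < b \<and> (\<forall>r. s < r \<and> r \<le> A \<and> (s = 0 \<or> \<delta>\<^sub>0 \<le> r) \<longrightarrow>
        \<bar>W r - bubble n r\<bar> \<le> \<epsilon> \<and> \<bar>(W1 r - bubble' n r) / r\<bar> \<le> \<epsilon> \<and> \<bar>W2 r - bubble'' n r\<bar> \<le> \<epsilon>)"
      by blast
  qed
qed

text \<open>This is 6 B for the bound \<open>B\<close> on the energy after \<open>m\<close> nodal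
  intervals, with the friction \<open>k\<close> written out in \<open>p\<close> so that the limit
  can be taken outside \<open>radial_ode\<close>. The 6 is that of
  \<open>turning_radius_bound\<close>.\<close>

definition energy_budget :: "nat \<Rightarrow> nat \<Rightarrow> real \<Rightarrow> real" where
  "energy_budget n m p = 6 * (real m * (2 * speed_bound n * orbit_bound n *
     (2 * (2 / (p - 1)) - (real n - 2))))"

lemma energy_budget_tendsto:
  assumes "3 \<le> n"
  shows "(energy_budget n m \<longlongrightarrow> 0) (at_left (pS (real n)))"
proof -
  have q1: "pS (real n) - 1 = 4 / (real n - 2)" using assms by (simp add: pS_def field_simps)
  have "((\<lambda>p. energy_budget n m p) \<longlongrightarrow> energy_budget n m (pS (real n))) (at_left (pS (real n)))"
    unfolding energy_budget_def using assms by (intro tendsto_intros) (simp add: q1)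
  moreover have "energy_budget n m (pS (real n)) = 0"
    unfolding energy_budget_def q1 using assms by simp
  ultimately show ?thesis by simp
qed

section \<open>Rescaling around a nodal maximum\<close>

context nodal_solution
begin

text \<open>Only the part of the nodal region outside its maximum point is used: there the rescaled
  profile starts at 1 with slope 0, stays in [0,1] and ends at 0. The absolute value keeps the base
  of \<open>powr\<close> nonnegative for every \<open>p\<close>, as the later passage to the limit
  requires.\<close>

lemma rescaled_arc:
  assumes i: "i < m" and budget: "\<bar>energy_budget CARD('n) m p\<bar> < 1"
  obtains s b W W1 W2 L where "lane_emden_arc CARD('n) p s b W W1 W2"
    "continuous_on {s..b} W" "W b = 0"
    "s \<le> \<bar>energy_budget CARD('n) m p\<bar> powr (1 / (6 * (real CARD('n) - 2)))"
    "\<And>x. norm x < b \<Longrightarrow> (-1) ^ i * z_resc u m p i x = W (norm x)"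
    "\<And>x. s < norm x \<Longrightarrow> norm x < b \<Longrightarrow> x \<in> z_dom u m p i"
    "i = 0 \<Longrightarrow> s = 0 \<and> 0 \<in> z_dom u m p 0 \<and> (W has_real_derivative 0) (at 0) \<and>
       (W1 has_real_derivative L) (at 0)"
proof -
  obtain v1 v2 where ode: "radial_ode CARD('n) p v v1 v2" by (rule profile_ode)
  interpret ode: radial_ode "CARD('n)" p v v1 v2 by (rule ode)
  obtain \<rho> where \<rho>: "R i \<le> \<rho>" "\<rho> < R (Suc i)" "i = 0 \<longleftrightarrow> \<rho> = 0" "v1 \<rho> = 0"
    "0 < (-1) ^ i * v \<rho>" "nodal_max u m i = \<bar>v \<rho>\<bar>" "i \<noteq> 0 \<longrightarrow> R i < \<rho>"
    "\<And>r. R i \<le> r \<Longrightarrow> r \<le> R (Suc i) \<Longrightarrow> \<bar>v r\<bar> \<le> \<bar>v \<rho>\<bar>"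
    by (rule turning_point[OF ode i]) blast
  have ic: "i \<le> card zeros" using i card_zeros by simp
  have R1: "0 \<le> R i" "R (Suc i) \<le> 1" using R_bounds[of i] R_bounds[of "Suc i"] ic by auto
  have \<rho>0: "0 \<le> \<rho>" "\<rho> < 1" using \<rho> R1 by auto
  define M where "M = \<bar>v \<rho>\<bar>"
  define \<sigma> :: real where "\<sigma> = (-1) ^ i"
  have \<sigma>: "\<sigma> = 1 \<or> \<sigma> = -1" unfolding \<sigma>_def by (cases "even i") auto
  have M: "0 < M" using \<rho>(5) by (auto simp: M_def)
  have \<sigma>v: "\<sigma> * v t = \<bar>v t\<bar>" if "R i \<le> t" "t \<le> R (Suc i)" for t
  proof -
    have "0 \<le> \<sigma> * v t"
    proof (cases "t = 0")
      case True
      then have "i = 0" using that R1 R_strict[of 0 i] ic R_0 by (cases "i = 0") auto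
      then show ?thesis using True v_0_pos by (simp add: \<sigma>_def)
    next
      case False
      then show ?thesis using v_sign_closed[OF i that] that R1 by (simp add: \<sigma>_def)
    qed
    then show ?thesis using \<sigma> by auto
  qed
  define \<mu> where "\<mu> = M powr ((p - 1) / 2)"
  have \<mu>: "0 < \<mu>" using M by (simp add: \<mu>_def)
  \<comment> \<open>The scaling of the equation: two derivatives and the amplitude give \<mu>^2 M,
    the nonlinearity gives M^p.\<close>
  have \<mu>M: "\<mu>\<^sup>2 * M = M powr p"
  proof -
    have "\<mu>\<^sup>2 = M powr (p - 1)"
      using M unfolding \<mu>_def by (simp add: power2_eq_square powr_add[symmetric])
    then show ?thesis using M powr_add[of M "p - 1" 1] by simp
  qed
  define W where "W r = \<sigma> * v (r / \<mu>) / M" for r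
  define W1 where "W1 r = \<sigma> * v1 (r / \<mu>) / (\<mu> * M)" for r
  define W2 where "W2 r = \<sigma> * v2 (r / \<mu>) / (\<mu>\<^sup>2 * M)" for r
  define s where "s = \<mu> * \<rho>"
  define b where "b = \<mu> * R (Suc i)"
  have in_range: "\<rho> \<le> r / \<mu>" "r / \<mu> \<le> R (Suc i)" if "s \<le> r" "r \<le> b" for r
    using that \<mu> by (auto simp: s_def b_def field_simps)
  have in_range': "\<rho> < r / \<mu>" "r / \<mu> < R (Suc i)" if "s < r" "r < b" for r
    using that \<mu> by (auto simp: s_def b_def field_simps)
  have W_deriv: "(W has_real_derivative W1 r) (at r)"
    and W1_deriv: "(W1 has_real_derivative W2 r) (at r)" if "\<bar>r / \<mu>\<bar> < 1" for r
  proof -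
    have d: "((\<lambda>r. r / \<mu>) has_real_derivative 1 / \<mu>) (at r)" by (rule DERIV_cdivide[OF DERIV_ident])
    have "((\<lambda>r. v (r / \<mu>)) has_real_derivative v1 (r / \<mu>) * (1 / \<mu>)) (at r)"
      by (rule DERIV_chain2[OF ode.v_deriv[OF that] d])
    from DERIV_cdivide[OF DERIV_cmult[OF this, of \<sigma>], of M] show "(W has_real_derivative W1 r) (at r)"
      unfolding W_def[abs_def] W1_def by (simp add: mult.commute)
    have "((\<lambda>r. v1 (r / \<mu>)) has_real_derivative v2 (r / \<mu>) * (1 / \<mu>)) (at r)"
      by (rule DERIV_chain2[OF ode.v1_deriv[OF that] d])
    from DERIV_cdivide[OF DERIV_cmult[OF this, of \<sigma>], of "\<mu> * M"]
    show "(W1 has_real_derivative W2 r) (at r)"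
      unfolding W1_def[abs_def] W2_def by (simp add: power2_eq_square mult_ac)
  qed
  have W_cont: "continuous_on {s..b} W"
  proof -
    have "continuous_on {s..b} (\<lambda>r. v (r / \<mu>))"
    proof (rule continuous_on_compose2[OF v_cont])
      show "continuous_on {s..b} (\<lambda>r. r / \<mu>)" using \<mu> by (intro continuous_intros) auto
      show "(\<lambda>r. r / \<mu>) ` {s..b} \<subseteq> {0..1}"
      proof
        fix t assume "t \<in> (\<lambda>r. r / \<mu>) ` {s..b}"
        then obtain r where "t = r / \<mu>" "r \<in> {s..b}" by blast
        then show "t \<in> {0..1}" using in_range[of r] R1 \<rho>0 by simp
      qed
    qed
    then show ?thesis unfolding W_def using M by (intro continuous_intros) auto
  qed
  have arc: "lane_emden_arc CARD('n) p s b W W1 W2"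
  proof
    show "3 \<le> CARD('n)" "1 < p" "p \<le> pS (real CARD('n))" using dim ode.p_gt_1 p_range by auto
    show "0 \<le> s" "s < b" using \<mu> \<rho> \<rho>0 by (auto simp: s_def b_def)
    show "continuous_on {s..<b} W" by (rule continuous_on_subset[OF W_cont]) auto
    have "continuous_on {s..<b} (\<lambda>r. v1 (r / \<mu>))"
    proof (rule continuous_on_compose2[OF ode.continuous_on_v1[OF order_refl]])
      show "continuous_on {s..<b} (\<lambda>r. r / \<mu>)" using \<mu> by (intro continuous_intros) auto
      show "(\<lambda>r. r / \<mu>) ` {s..<b} \<subseteq> {- 1<..<1}"
      proof
        fix t assume "t \<in> (\<lambda>r. r / \<mu>) ` {s..<b}"
        then obtain r where "t = r / \<mu>" "r \<in> {s..<b}" by blast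
        then have "\<rho> \<le> t" "t < R (Suc i)" using \<mu> by (auto simp: s_def b_def field_simps)
        then show "t \<in> {- 1<..<1}" using \<rho>0 R1 by simp
      qed
    qed
    then show "continuous_on {s..<b} W1" unfolding W1_def using M \<mu> by (intro continuous_intros) auto
    show "W s = 1" using \<mu> M \<sigma>v[of \<rho>] \<rho> by (simp add: W_def s_def M_def)
    show "W1 s = 0" using \<mu> \<rho> by (simp add: W1_def s_def)
    show "(W has_real_derivative W1 r) (at r)" "(W1 has_real_derivative W2 r) (at r)"
      if "s < r" "r < b" for r
    proof -
      have "\<bar>r / \<mu>\<bar> < 1" using in_range'[OF that] \<rho>0 R1 by simp
      then show "(W has_real_derivative W1 r) (at r)" "(W1 has_real_derivative W2 r) (at r)"
        by (rule W_deriv, rule W1_deriv)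
    qed
    show "W2 r = - ((real CARD('n) - 1) / r * W1 r) - W r powr p" if "s < r" "r < b" for r
    proof -
      define t where "t = r / \<mu>"
      have t: "\<rho> < t" "t < R (Suc i)" using in_range'[OF that] by (auto simp: t_def)
      have t0: "0 < t" "t < 1" using t \<rho>0 R1 by auto
      have r: "r = \<mu> * t" using \<mu> by (simp add: t_def)
      have "R i < t" using t \<rho> by simp
      then have vt: "\<sigma> * v t = \<bar>v t\<bar>" "v t \<noteq> 0"
        using \<sigma>v[of t] t v_nonzero_between[OF ic, of t] by auto
      \<comment> \<open>Inside one nodal interval \<sigma> v = |v|, so the pure power of
        \<open>W\<close> is the rescaled odd nonlinearity.\<close>
      have "W r powr p = \<bar>v t\<bar> powr p / M powr p"
        using M by (simp add: W_def t_def[symmetric] vt powr_divide)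
      also have "\<bar>v t\<bar> powr p = \<sigma> * (\<bar>v t\<bar> powr (p - 1) * v t)"
        using powr_add[of "\<bar>v t\<bar>" "p - 1" 1] vt by (simp add: mult.left_commute)
      finally have Wp: "W r powr p = \<sigma> * (\<bar>v t\<bar> powr (p - 1) * v t) / (\<mu>\<^sup>2 * M)"
        unfolding \<mu>M .
      show ?thesis
        unfolding Wp W1_def W2_def t_def[symmetric]
        unfolding ode.ode[OF t0] r
        using \<mu> M t0 by (simp add: field_simps power2_eq_square)
    qed
    show "0 \<le> W r \<and> W r \<le> 1" if "s \<le> r" "r < b" for r
    proof -
      have "\<rho> \<le> r / \<mu>" "r / \<mu> \<le> R (Suc i)" using in_range[of r] that by auto
      then have "\<sigma> * v (r / \<mu>) = \<bar>v (r / \<mu>)\<bar>" "\<bar>v (r / \<mu>)\<bar> \<le> M"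
        using \<sigma>v \<rho>(8) \<rho>(1) by (auto simp: M_def)
      then show ?thesis using M by (simp add: W_def)
    qed
  qed
  have Wb: "W b = 0" using \<mu> v_R[of "Suc i"] i by (simp add: W_def b_def)
  have s_le: "s \<le> \<bar>energy_budget CARD('n) m p\<bar> powr (1 / (6 * (real CARD('n) - 2)))"
  proof (cases "i = 0")
    case True
    then show ?thesis using \<rho> by (simp add: s_def)
  next
    case False
    define B where "B = real m * (2 * speed_bound CARD('n) * orbit_bound CARD('n) * ode.k)"
    have eb: "energy_budget CARD('n) m p = 6 * B"
      by (simp add: energy_budget_def B_def ode.k_def ode.\<alpha>_def)
    have K0: "0 \<le> 2 * speed_bound CARD('n) * orbit_bound CARD('n) * ode.k"
      using ode.speed_bound_pos ode.k_pos by (simp add: orbit_bound_def)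
    then have B0: "0 \<le> B" by (simp add: B_def)
    have \<rho>01: "0 < \<rho>" using \<rho>0 \<rho>(3) False by simp
    have "ode.E \<rho> \<le> real (Suc i) * (2 * speed_bound CARD('n) * orbit_bound CARD('n) * ode.k)"
    proof (rule ode.E_bound[where R = R and m = m])
      show "R 0 = 0" by (rule R_0)
      show "R m = 1" using R_last card_zeros by simp
      show "R j < R (Suc j)" if "j < m" for j using R_Suc that card_zeros by simp
      show "0 \<le> (-1) ^ j * v r" if "j < m" "R j \<le> r" "r \<le> R (Suc j)" "0 < r" "r < 1" for j r
        using v_sign_closed that by simp
      show "real m * (2 * speed_bound CARD('n) * orbit_bound CARD('n) * ode.k) < 1"
        using budget B0 unfolding eb by (simp add: B_def)
    qed (use i \<rho> \<rho>0 \<rho>01 in auto)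
    also have "\<dots> \<le> B" unfolding B_def using i K0 by (intro mult_right_mono) auto
    finally have "ode.E \<rho> \<le> B" .
    then have "\<bar>v \<rho>\<bar> powr ((p - 1) / 2) * \<rho> \<le> (6 * B) powr (1 / (6 * (real CARD('n) - 2)))"
      using budget B0 unfolding eb by (intro ode.turning_radius_bound \<rho>01 \<rho>0 \<rho>(4)) auto
    then show ?thesis using B0 unfolding eb by (simp add: s_def \<mu>_def M_def)
  qed
  have z_eq: "(-1) ^ i * z_resc u m p i x = W (norm x)" if "norm x < b" for x
  proof -
    have inv: "M powr - ((p - 1) / 2) = 1 / \<mu>" by (simp add: \<mu>_def powr_minus_divide)
    have nx: "norm ((1 / \<mu>) *\<^sub>R x) = norm x / \<mu>" using \<mu> by simp
    have "norm x / \<mu> < R (Suc i)" using that \<mu> by (simp add: b_def field_simps)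
    then have "norm ((1 / \<mu>) *\<^sub>R x) \<le> 1" using R1 unfolding nx by simp
    then have "u ((1 / \<mu>) *\<^sub>R x) = v (norm x / \<mu>)" by (metis u_eq nx)
    then show ?thesis
      unfolding z_resc_def \<rho>(6) M_def[symmetric] inv by (simp add: W_def \<sigma>_def)
  qed
  have dom: "x \<in> z_dom u m p i" if "(1 / \<mu>) *\<^sub>R x \<in> shell i" for x
  proof -
    have "(1 / \<mu>) *\<^sub>R x \<in> T_set u m i" using that i unfolding T_set_def nodal_region_eq by auto
    moreover have "x = (nodal_max u m i powr ((p - 1) / 2)) *\<^sub>R ((1 / \<mu>) *\<^sub>R x)"
      unfolding \<rho>(6) M_def[symmetric] \<mu>_def[symmetric] using \<mu> by simp
    ultimately show ?thesis unfolding z_dom_def by blast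
  qed
  have dom': "x \<in> z_dom u m p i" if "s < norm x" "norm x < b" for x
  proof (rule dom)
    have "\<rho> < norm x / \<mu>" "norm x / \<mu> < R (Suc i)" using in_range'[OF that] .
    then show "(1 / \<mu>) *\<^sub>R x \<in> shell i" using \<rho>(1) \<mu> by (simp add: shell_def)
  qed
  \<comment> \<open>For \<open>i = 0\<close> the arc starts at the origin, and \<open>W2 0\<close>
    is the value needed later for the second derivatives there.\<close>
  show thesis
  proof (rule that[OF arc W_cont Wb s_le z_eq dom', of "W2 0"])
    assume i0: "i = 0"
    have "(0 :: real^'n) \<in> shell i" using \<rho>(1,2) R1 i0 by (simp add: shell_def R_0)
    then have "0 \<in> z_dom u m p i" by (intro dom) simp
    moreover have "W1 0 = 0" by (simp add: W1_def ode.v1_0)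
    then have "(W has_real_derivative 0) (at 0)" using W_deriv[of 0] by simp
    moreover have "(W1 has_real_derivative W2 0) (at 0)" by (rule W1_deriv) simp
    ultimately show "s = 0 \<and> 0 \<in> z_dom u m p 0 \<and> (W has_real_derivative 0) (at 0) \<and>
       (W1 has_real_derivative W2 0) (at 0)"
      using i0 \<rho>(3) by (simp add: s_def)
  qed auto
qed

end

section \<open>From radial estimates to the C2 distance\<close>

lemma abs_C2_dist_le:
  fixes f g :: "real^'n::finite \<Rightarrow> real"
  assumes "0 \<le> c" and "\<And>x. x \<in> K \<Longrightarrow> \<bar>f x - g x\<bar> + (\<Sum>i\<in>UNIV. \<bar>pd i (\<lambda>x. f x - g x) x\<bar>)
      + (\<Sum>i\<in>UNIV. \<Sum>j\<in>UNIV. \<bar>pd i (pd j (\<lambda>x. f x - g x)) x\<bar>) \<le> c"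
  shows "\<bar>C2_dist K f g\<bar> \<le> c"
proof -
  let ?S = "insert 0 ((\<lambda>x. \<bar>f x - g x\<bar> + (\<Sum>i\<in>UNIV. \<bar>pd i (\<lambda>x. f x - g x) x\<bar>)
      + (\<Sum>i\<in>UNIV. \<Sum>j\<in>UNIV. \<bar>pd i (pd j (\<lambda>x. f x - g x)) x\<bar>)) ` K)"
  have le: "y \<le> c" if "y \<in> ?S" for y using that assms by auto
  \<comment> \<open>Boundedness comes first: \<open>Sup\<close> of an unbounded set of reals carries
    no information.\<close>
  then have "bdd_above ?S" by (intro bdd_aboveI[of _ c])
  then have "0 \<le> Sup ?S" by (intro cSup_upper) auto
  moreover have "Sup ?S \<le> c" using le by (intro cSup_least) auto
  ultimately show ?thesis by (simp add: C2_dist_def Let_def)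
qed

text \<open>Both kinds of region are treated together. For \<open>i = 0\<close> the arc starts at
  \<open>s = 0\<close> and \<open>K\<close> may contain the origin; for i >= 1 the set
  \<open>K\<close> keeps a distance \<open>\<delta>\<^sub>0\<close> from it, and \<open>s\<close>
  eventually falls below that distance.\<close>

lemma C2loc_conv_rescaled:
  fixes u :: "real \<Rightarrow> real^'n::finite \<Rightarrow> real"
  assumes dim: "3 \<le> CARD('n)" and m: "1 \<le> m" and i: "i < m"
    and sol: "\<And>p. 1 < p \<Longrightarrow> p < pS (real CARD('n)) \<Longrightarrow> radial_sol m p (u p)"
  shows "C2loc_conv_left (\<lambda>p x. (-1) ^ i * z_resc (u p) m p i x) (\<lambda>p. z_dom (u p) m p i)
    U_bubble (if i = 0 then UNIV else UNIV - {0}) (pS (real CARD('n)))"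
  unfolding C2loc_conv_left_def
proof (intro allI impI)
  fix K :: "(real^'n) set"
  assume K: "compact K \<and> K \<subseteq> (if i = 0 then UNIV else UNIV - {0})"
  define n where "n = CARD('n)"
  have n3: "3 \<le> n" using dim by (simp add: n_def)
  obtain A where A: "0 < A" "\<And>x. x \<in> K \<Longrightarrow> norm x \<le> A"
    using compact_imp_bounded[of K] K unfolding bounded_pos by blast
  obtain \<delta>\<^sub>0 where \<delta>0: "0 < \<delta>\<^sub>0" "\<And>x. x \<in> K \<Longrightarrow> i \<noteq> 0 \<Longrightarrow> \<delta>\<^sub>0 \<le> norm x"
  proof (cases "i = 0")
    case True
    then show thesis using that[of 1] by simp
  next
    case False
    then have "0 \<notin> K" using K by auto
    then obtain d where "0 < d" "\<forall>x\<in>K. d \<le> dist 0 x"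
      using separate_point_closed[of K 0] K compact_imp_closed by blast
    then show thesis using that[of d] by simp
  qed
  \<comment> \<open>The constant of \<open>C2_size_le\<close> divided by its common factor
    e.\<close>
  define c where "c = 1 + n * A + n * (n * 3)"
  have c: "0 < c" using A by (simp add: c_def add_pos_nonneg)
  have main: "\<forall>\<^sub>F p in at_left (pS (real n)). K \<subseteq> z_dom (u p) m p i \<and>
      \<bar>C2_dist K (\<lambda>x. (-1) ^ i * z_resc (u p) m p i x) U_bubble\<bar> \<le> \<epsilon> * c" if \<epsilon>: "0 < \<epsilon>" for \<epsilon>
  proof -
    obtain \<eta> where \<eta>: "0 < \<eta>"
      "\<And>p s b W W1 W2. lane_emden_arc n p s b W W1 W2 \<Longrightarrow> pS (real n) - p < \<eta> \<Longrightarrow> s < \<eta> \<Longrightarrow>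
        continuous_on {s..b} W \<Longrightarrow> W b = 0 \<Longrightarrow> A < b \<and>
        (\<forall>r. s < r \<and> r \<le> A \<and> (s = 0 \<or> \<delta>\<^sub>0 \<le> r) \<longrightarrow> \<bar>W r - bubble n r\<bar> \<le> \<epsilon> \<and>
           \<bar>(W1 r - bubble' n r) / r\<bar> \<le> \<epsilon> \<and> \<bar>W2 r - bubble'' n r\<bar> \<le> \<epsilon>)"
      using lane_emden_arc_converges[OF n3 A(1) \<delta>0(1) \<epsilon>] by blast
    have ex: "0 < 1 / (6 * (real n - 2))" using n3 by simp
    have "((\<lambda>p. \<bar>energy_budget n m p\<bar>) \<longlongrightarrow> 0) (at_left (pS (real n)))"
      using tendsto_rabs[OF energy_budget_tendsto[OF n3]] by simp
    note budget = this
    have "((\<lambda>p. \<bar>energy_budget n m p\<bar> powr (1 / (6 * (real n - 2)))) \<longlongrightarrow> 0 powr (1 / (6 * (real n - 2))))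
        (at_left (pS (real n)))"
      using ex by (intro tendsto_powr' budget tendsto_const) auto
    then have "((\<lambda>p. \<bar>energy_budget n m p\<bar> powr (1 / (6 * (real n - 2)))) \<longlongrightarrow> 0) (at_left (pS (real n)))"
      by simp
    then have e1: "\<forall>\<^sub>F p in at_left (pS (real n)).
        \<bar>energy_budget n m p\<bar> powr (1 / (6 * (real n - 2))) < min \<eta> \<delta>\<^sub>0"
      using \<eta>(1) \<delta>0(1) by (intro order_tendstoD(2)) auto
    have e2: "\<forall>\<^sub>F p in at_left (pS (real n)). \<bar>energy_budget n m p\<bar> < 1"
      by (rule order_tendstoD(2)[OF budget]) simp
    \<comment> \<open>Besides being close to pS, \<open>p\<close> has to exceed n/(n-2), as
      \<open>nodal_solution\<close> asks.\<close>
    have "max (pS (real n) - \<eta>) (real n / (real n - 2)) < pS (real n)"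
      using \<eta>(1) n3 by (simp add: pS_def divide_strict_right_mono)
    then have e3: "\<forall>\<^sub>F p in at_left (pS (real n)).
        p \<in> {max (pS (real n) - \<eta>) (real n / (real n - 2))<..<pS (real n)}"
      by (rule eventually_at_left_real)
    from e1 e2 e3 show ?thesis
    proof eventually_elim
      case (elim p)
      have n1: "1 < real n / (real n - 2)" using n3 by simp
      have p: "real n / (real n - 2) \<le> p" "p < pS (real n)" "pS (real n) - p < \<eta>" "1 < p"
        using elim(3) n1 by auto
      interpret nodal_solution "u p" m p
        using dim m p sol[of p] by unfold_locales (auto simp: n_def)
      obtain s b W W1 W2 L where arc: "lane_emden_arc n p s b W W1 W2"
        and W_cont: "continuous_on {s..b} W" and Wb: "W b = 0"
        and s_le: "s \<le> \<bar>energy_budget n m p\<bar> powr (1 / (6 * (real n - 2)))"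
        and z: "\<And>x. norm x < b \<Longrightarrow> (-1) ^ i * z_resc (u p) m p i x = W (norm x)"
        and dom: "\<And>x. s < norm x \<Longrightarrow> norm x < b \<Longrightarrow> x \<in> z_dom (u p) m p i"
        and at0: "i = 0 \<Longrightarrow> s = 0 \<and> 0 \<in> z_dom (u p) m p 0 \<and> (W has_real_derivative 0) (at 0) \<and>
          (W1 has_real_derivative L) (at 0)"
        using rescaled_arc[OF i elim(2)[unfolded n_def], folded n_def] by metis
      interpret arc: lane_emden_arc n p s b W W1 W2 by (rule arc)
      have s: "s < \<eta>" "s < \<delta>\<^sub>0" using s_le elim(1) by auto
      have Ab: "A < b" and est: "\<And>r. s < r \<Longrightarrow> r \<le> A \<Longrightarrow> s = 0 \<or> \<delta>\<^sub>0 \<le> r \<Longrightarrow>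
          \<bar>W r - bubble n r\<bar> \<le> \<epsilon> \<and> \<bar>(W1 r - bubble' n r) / r\<bar> \<le> \<epsilon> \<and> \<bar>W2 r - bubble'' n r\<bar> \<le> \<epsilon>"
        using \<eta>(2)[OF arc p(3) s(1) W_cont Wb] by auto
      have K_range: "s < norm x" "s = 0 \<or> \<delta>\<^sub>0 \<le> norm x" if "x \<in> K" "x \<noteq> 0 \<or> i \<noteq> 0" for x
        using that at0 \<delta>0(2)[of x] s by (cases "i = 0"; force)+
      let ?h = "\<lambda>x. (-1) ^ i * z_resc (u p) m p i x - U_bubble x"
      interpret h: radial_function ?h "\<lambda>r. W r - bubble n r" "\<lambda>r. W1 r - bubble' n r"
        "\<lambda>r. W2 r - bubble'' n r" s b
      proof
        show "0 \<le> s" by (rule arc.s(1))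
        show "?h x = W (norm x) - bubble n (norm x)" if "norm x < b" for x
          using z[OF that] by (simp add: U_bubble_eq n_def)
        show "((\<lambda>r. W r - bubble n r) has_real_derivative W1 r - bubble' n r) (at r)"
          "((\<lambda>r. W1 r - bubble' n r) has_real_derivative W2 r - bubble'' n r) (at r)"
          if "s < r" "r < b" for r
          using that arc.s(1) n3
          by (auto intro!: DERIV_diff arc.W_deriv arc.W1_deriv bubble_deriv bubble'_deriv)
      qed
      have size: "\<bar>?h x\<bar> + (\<Sum>i\<in>UNIV. \<bar>pd i ?h x\<bar>) + (\<Sum>i\<in>UNIV. \<Sum>j\<in>UNIV. \<bar>pd i (pd j ?h) x\<bar>) \<le> \<epsilon> * c"
        if x: "x \<in> K" for x
      proof -
        have "\<bar>?h x\<bar> + (\<Sum>i\<in>UNIV. \<bar>pd i ?h x\<bar>) + (\<Sum>i\<in>UNIV. \<Sum>j\<in>UNIV. \<bar>pd i (pd j ?h) x\<bar>)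
            \<le> \<epsilon> + CARD('n) * (\<epsilon> * A) + CARD('n) * (CARD('n) * (3 * \<epsilon>))"
        proof (cases "x = 0 \<and> i = 0")
          case False
          then have r: "s < norm x" "s = 0 \<or> \<delta>\<^sub>0 \<le> norm x" using K_range[OF x] by auto
          show ?thesis
            by (rule h.C2_size_le) (use r est[of "norm x"] A(2)[OF x] Ab in auto)
        next
          case True
          then have s0: "s = 0" and W': "(W has_real_derivative 0) (at 0)"
            and W1': "(W1 has_real_derivative L) (at 0)" using at0 by auto
          \<comment> \<open>Both \<open>W1\<close> and \<open>bubble'\<close> vanish at 0, so the
            quotient by \<open>r\<close> is a difference quotient; its limit is the difference of
            the second derivatives \<open>L\<close> and -1/n.\<close>
          have quot: "((\<lambda>r. (W1 r - bubble' n r) / r) \<longlongrightarrow> L - - (1 / real n)) (at_right 0)"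
          proof -
            have "((\<lambda>r. W1 r - bubble' n r) has_real_derivative L - - (1 / real n)) (at 0)"
              by (intro DERIV_diff W1' bubble'_deriv_0 n3)
            then have "((\<lambda>r. (W1 r - bubble' n r) / r) \<longlongrightarrow> L - - (1 / real n)) (at 0)"
              using arc.W1_s s0 by (simp add: DERIV_def)
            then show ?thesis by (rule tendsto_within_subset) simp
          qed
          interpret h0: radial_function_at_0 ?h "\<lambda>r. W r - bubble n r" "\<lambda>r. W1 r - bubble' n r"
            "\<lambda>r. W2 r - bubble'' n r" b "L - - (1 / real n)"
          proof (intro radial_function_at_0.intro radial_function_at_0_axioms.intro)
            show "radial_function ?h (\<lambda>r. W r - bubble n r) (\<lambda>r. W1 r - bubble' n r)
              (\<lambda>r. W2 r - bubble'' n r) 0 b"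
              using h.radial_function_axioms s0 by simp
            show "0 < b" using A Ab by simp
            show "?h 0 = W 0 - bubble n 0" using z[of 0] A Ab by (simp add: U_bubble_eq n_def)
            have "((\<lambda>r. W r - bubble n r) has_real_derivative 0 - bubble' n 0) (at 0)"
              by (intro DERIV_diff W' bubble_deriv n3)
            then have "((\<lambda>r. (W r - bubble n r - (W 0 - bubble n 0)) / r) \<longlongrightarrow> 0) (at 0)"
              by (simp add: DERIV_def)
            then show "((\<lambda>r. (W r - bubble n r - (W 0 - bubble n 0)) / r) \<longlongrightarrow> 0) (at_right 0)"
              by (rule tendsto_within_subset) simp
          qed (rule quot)
          \<comment> \<open>The centre inherits the bound from the positive radii, since the
            estimate of the quotient passes to the limit.\<close>
          have "\<bar>L - - (1 / real n)\<bar> \<le> \<epsilon>"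
          proof (rule tendsto_upperbound[OF tendsto_rabs[OF quot]])
            show "\<forall>\<^sub>F r in at_right 0. \<bar>(W1 r - bubble' n r) / r\<bar> \<le> \<epsilon>"
              using eventually_at_right_real[OF A(1)] by (rule eventually_mono) (use est s0 in auto)
          qed simp
          moreover have "\<bar>W 0 - bubble n 0\<bar> \<le> \<epsilon>" using arc.W_s s0 bubble_0[OF n3] \<epsilon> by simp
          ultimately show ?thesis using h0.C2_size_0_le[of \<epsilon> A] A True by simp
        qed
        also have "\<dots> = \<epsilon> * c" by (simp add: c_def n_def algebra_simps)
        finally show ?thesis .
      qed
      have "K \<subseteq> z_dom (u p) m p i"
      proof
        fix x assume x: "x \<in> K"
        show "x \<in> z_dom (u p) m p i"
        proof (cases "x = 0 \<and> i = 0")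
          case False
          then show ?thesis using K_range[OF x] dom[of x] A(2)[OF x] Ab by auto
        qed (use at0 in simp)
      qed
      moreover have "\<bar>C2_dist K (\<lambda>x. (-1) ^ i * z_resc (u p) m p i x) U_bubble\<bar> \<le> \<epsilon> * c"
        by (rule abs_C2_dist_le) (use size \<epsilon> c in auto)
      ultimately show ?case by blast
    qed
  qed
  show "(\<forall>\<^sub>F p in at_left (pS (real CARD('n))). K \<subseteq> z_dom (u p) m p i) \<and>
      ((\<lambda>p. C2_dist K (\<lambda>x. (-1) ^ i * z_resc (u p) m p i x) U_bubble) \<longlongrightarrow> 0)
        (at_left (pS (real CARD('n))))"
  proof
    show "\<forall>\<^sub>F p in at_left (pS (real CARD('n))). K \<subseteq> z_dom (u p) m p i"
      \<comment> \<open>Any value of \<epsilon> serves for the domain; 1 is taken.\<close>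
      using main[OF zero_less_one] unfolding n_def by (rule eventually_mono) blast
    show "((\<lambda>p. C2_dist K (\<lambda>x. (-1) ^ i * z_resc (u p) m p i x) U_bubble) \<longlongrightarrow> 0)
        (at_left (pS (real CARD('n))))"
    proof (rule tendstoI)
      fix \<epsilon> :: real assume "0 < \<epsilon>"
      then have "0 < \<epsilon> / (2 * c)" using c by simp
      from main[OF this]
      show "\<forall>\<^sub>F p in at_left (pS (real CARD('n))).
          dist (C2_dist K (\<lambda>x. (-1) ^ i * z_resc (u p) m p i x) U_bubble) 0 < \<epsilon>"
        unfolding n_def[symmetric]
        by (rule eventually_mono) (use c \<open>0 < \<epsilon>\<close> in \<open>auto simp: dist_real_def\<close>)
    qed
  qed
qed

theorem theorem3p7:
  fixes u :: "real \<Rightarrow> real^'n::finite \<Rightarrow> real" and m :: nat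
  assumes "CARD('n) \<ge> 3"
    and "m \<ge> 1"
    and "\<And>p. 1 < p \<Longrightarrow> p < pS (real CARD('n)) \<Longrightarrow> radial_sol m p (u p)"
  shows "C2loc_conv_left (\<lambda>p. z_resc (u p) m p 0) (\<lambda>p. z_dom (u p) m p 0) U_bubble
            UNIV (pS (real CARD('n)))
       \<and> (m \<ge> 2 \<longrightarrow> (\<forall>i\<in>{1..<m}.
            C2loc_conv_left (\<lambda>p x. (-1) ^ i * z_resc (u p) m p i x) (\<lambda>p. z_dom (u p) m p i)
              U_bubble (UNIV - {0}) (pS (real CARD('n)))))"
proof (intro conjI impI ballI)
  show "C2loc_conv_left (\<lambda>p. z_resc (u p) m p 0) (\<lambda>p. z_dom (u p) m p 0) U_bubble
      UNIV (pS (real CARD('n)))"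
    using C2loc_conv_rescaled[OF assms(1,2) _ assms(3), of 0] assms(2) by simp
  fix i assume "i \<in> {1..<m}"
  then show "C2loc_conv_left (\<lambda>p x. (-1) ^ i * z_resc (u p) m p i x) (\<lambda>p. z_dom (u p) m p i)
      U_bubble (UNIV - {0}) (pS (real CARD('n)))"
    using C2loc_conv_rescaled[OF assms(1,2) _ assms(3), of i] by simp
qed

end
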